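(* Let $d\ge 1$, let $\{q_j\}_{j=1}^d$ be $\mathbb Q$-independent integers, let $P_1,\dots,P_d$ be non-constant polynomials (in one variable, with complex coefficients), and suppose that \[\varphi(s)=\sum_{j=1}^d P_j(q_j^{-s})\] belongs to $\mathcal G$. Then $\mathcal C_\varphi$ is compact on $\mathcal H^2$ if and only if $\varphi$ has restricted range or $d\geq2$.
   Context: For $\theta\in\mathbb R$, $\mathbb C_\theta=\{s\in\mathbb C: \mathrm{Re}\,s>\theta\}$. $\mathcal H^2$ is the Hilbert space of Dirichlet series $f(s)=\sum_{n\ge1}a_nn^{-s}$ with norm $\|f\|_{\mathcal H^2}^2=\sum_{n\ge1}|a_n|^2<\infty$; its elements are analytic in $\mathbb C_{1/2}$. The Gordon--Hedenmalm class $\mathcal G$ is the set of functions $\varphi:\mathbb C_{1/2}\to\mathbb C_{1/2}$ of the form $\varphi(s)=c_0s+\varphi_0(s)$ with $\varphi_0(s)=\sum_{n\ge1}c_nn^{-s}$, where $c_0$ is a non-negative integer (the characteristic of $\varphi$), the Dirichlet series $\varphi_0$ converges uniformly in $\mathbb C_\varepsilon$ for every $\varepsilon>0$, and: (a) if $c_0=0$ then $\varphi_0(\mathbb C_0)\subset\mathbb C_{1/2}$; (b) if $c_0\ge1$ then either $\varphi_0\equiv0$ or $\varphi_0(\mathbb C_0)\subset\mathbb C_0$. For $\varphi\in\mathcal G$, the operator $\mathcal C_\varphi f=f\circ\varphi$ is well defined and bounded on $\mathcal H^2$. Here the symbol has characteristic $c_0=0$. A Dirichlet polynomial symbol $\varphi\in\mathcal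 G$ with $c_0=0$ has unrestricted range if $\inf_{s\in\mathbb C_0}\mathrm{Re}\,\varphi(s)=1/2$; otherwise it has restricted range. A set $\Lambda\subseteq\mathbb N\setminus\{1\}$ of integers is $\mathbb Q$-independent if $\{\log n: n\in\Lambda\}$ is linearly independent over $\mathbb Q$ (the $q_j$ are distinct integers $\ge2$). *)

theory Defs
  imports
    "HOL-Analysis.Analysis"
    "HOL-Computational_Algebra.Polynomial"
begin

section \<open>Dirichlet series\<close>

definition right_halfplane :: "real \<Rightarrow> complex set"
  where "right_halfplane \<theta> = {s. \<theta> < Re s}"

text \<open>
  In Isabelle \<open>0 powr z = 0\<close>, so the term with index \<open>0\<close> vanishes and the sum effectively
  runs over \<open>n \<ge> 1\<close>.
\<close>
definition dirichlet_series :: "(nat \<Rightarrow> complex) \<Rightarrow> complex \<Rightarrow> complex"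
  where "dirichlet_series a s = (\<Sum>n. a n * of_nat n powr (- s))"


section \<open>The Hilbert space of Dirichlet series with square summable coefficients\<close>

text \<open>
  A series is represented by its coefficients; the unused coefficient at index \<open>0\<close> is pinned
  to \<open>0\<close>, so that distinct elements are distinct Dirichlet series.
\<close>
typedef dirichlet_h2 = "{a :: nat \<Rightarrow> complex. a 0 = 0 \<and> summable (\<lambda>n. (norm (a n))\<^sup>2)}"
  morphisms h2_coeff Abs_dirichlet_h2
  by (rule exI[of _ "\<lambda>_. 0"]) auto

setup_lifting type_definition_dirichlet_h2

definition h2_eval :: "dirichlet_h2 \<Rightarrow> complex \<Rightarrow> complex"
  where "h2_eval f = dirichlet_series (h2_coeff f)"

lemma h2_coeff_0 [simp]: "h2_coeff f 0 = 0"
  using h2_coeff[of f] by simp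

lemma h2_summable: "summable (\<lambda>n. (norm (h2_coeff f n))\<^sup>2)"
  using h2_coeff[of f] by simp

lemma norm_add_sq_le: "(norm (x + y :: complex))\<^sup>2 \<le> 2 * ((norm x)\<^sup>2 + (norm y)\<^sup>2)"
proof -
  have "(norm (x + y))\<^sup>2 \<le> (norm x + norm y)\<^sup>2"
    by (intro power_mono norm_triangle_ineq) auto
  also have "\<dots> \<le> 2 * ((norm x)\<^sup>2 + (norm y)\<^sup>2)"
    using sum_squares_bound[of "norm x" "norm y"] by (simp add: power2_sum)
  finally show ?thesis .
qed

lemma summable_norm_add_sq:
  fixes a b :: "nat \<Rightarrow> complex"
  assumes "summable (\<lambda>n. (norm (a n))\<^sup>2)" "summable (\<lambda>n. (norm (b n))\<^sup>2)"
  shows "summable (\<lambda>n. (norm (a n + b n))\<^sup>2)"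
  by (rule summable_comparison_test'[where N = 0 and
        g = "\<lambda>n. 2 * ((norm (a n))\<^sup>2 + (norm (b n))\<^sup>2)"])
     (use assms norm_add_sq_le in \<open>auto intro!: summable_mult summable_add\<close>)

lemma summable_inner_sq:
  fixes a b :: "nat \<Rightarrow> complex"
  assumes "summable (\<lambda>n. (norm (a n))\<^sup>2)" "summable (\<lambda>n. (norm (b n))\<^sup>2)"
  shows "summable (\<lambda>n. inner (a n) (b n))"
proof (rule summable_comparison_test'[where N = 0 and g = "\<lambda>n. (norm (a n))\<^sup>2 + (norm (b n))\<^sup>2"])
  show "summable (\<lambda>n. (norm (a n))\<^sup>2 + (norm (b n))\<^sup>2)"
    using assms by (rule summable_add)
  fix n :: nat
  have "norm (inner (a n) (b n)) \<le> norm (a n) * norm (b n)"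
    using Cauchy_Schwarz_ineq2[of "a n" "b n"] by simp
  also have "2 * \<dots> \<le> (norm (a n))\<^sup>2 + (norm (b n))\<^sup>2"
    using sum_squares_bound[of "norm (a n)" "norm (b n)"] by simp
  finally show "norm (inner (a n) (b n)) \<le> (norm (a n))\<^sup>2 + (norm (b n))\<^sup>2"
    by (smt (verit) norm_ge_zero mult_nonneg_nonneg)
qed

instantiation dirichlet_h2 :: real_inner
begin

lift_definition zero_dirichlet_h2 :: dirichlet_h2 is "\<lambda>_. 0" by auto

lift_definition plus_dirichlet_h2 :: "dirichlet_h2 \<Rightarrow> dirichlet_h2 \<Rightarrow> dirichlet_h2"
  is "\<lambda>a b n. a n + b n"
  by (auto intro: summable_norm_add_sq)

lift_definition uminus_dirichlet_h2 :: "dirichlet_h2 \<Rightarrow> dirichlet_h2"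
  is "\<lambda>a n. - a n" by auto

lift_definition minus_dirichlet_h2 :: "dirichlet_h2 \<Rightarrow> dirichlet_h2 \<Rightarrow> dirichlet_h2"
  is "\<lambda>a b n. a n - b n"
  subgoal for a b
    using summable_norm_add_sq[of a "\<lambda>n. - b n"] by auto
  done

lift_definition scaleR_dirichlet_h2 :: "real \<Rightarrow> dirichlet_h2 \<Rightarrow> dirichlet_h2"
  is "\<lambda>r a n. r *\<^sub>R a n"
  by (auto simp: power_mult_distrib)

definition norm_dirichlet_h2 :: "dirichlet_h2 \<Rightarrow> real"
  where "norm_dirichlet_h2 f = sqrt (\<Sum>n. (norm (h2_coeff f n))\<^sup>2)"

text \<open>The real part of the complex inner product \<open>\<Sum>n. a n * cnj (b n)\<close>.\<close>
definition inner_dirichlet_h2 :: "dirichlet_h2 \<Rightarrow> dirichlet_h2 \<Rightarrow> real"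
  where "inner_dirichlet_h2 f g = (\<Sum>n. inner (h2_coeff f n) (h2_coeff g n))"

definition dist_dirichlet_h2 :: "dirichlet_h2 \<Rightarrow> dirichlet_h2 \<Rightarrow> real"
  where "dist_dirichlet_h2 f g = norm (f - g)"

definition sgn_dirichlet_h2 :: "dirichlet_h2 \<Rightarrow> dirichlet_h2"
  where "sgn_dirichlet_h2 f = inverse (norm f) *\<^sub>R f"

definition uniformity_dirichlet_h2 :: "(dirichlet_h2 \<times> dirichlet_h2) filter"
  where "uniformity_dirichlet_h2 = (INF e\<in>{0<..}. principal {(x, y). dist x y < e})"

definition open_dirichlet_h2 :: "dirichlet_h2 set \<Rightarrow> bool"
  where "open_dirichlet_h2 U \<longleftrightarrow> (\<forall>x\<in>U. \<forall>\<^sub>F (x', y) in uniformity. x' = x \<longrightarrow> y \<in> U)"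

instance
proof
  fix f g h :: dirichlet_h2 and r r' :: real
  show "f + g + h = f + (g + h)" by transfer (simp add: add.assoc)
  show "f + g = g + f" by transfer (simp add: add.commute)
  show "0 + f = f" by transfer simp
  show "- f + f = 0" by transfer simp
  show "f - g = f + - g" by transfer simp
  show "r *\<^sub>R (f + g) = r *\<^sub>R f + r *\<^sub>R g" by transfer (simp add: scaleR_add_right)
  show "(r + r') *\<^sub>R f = r *\<^sub>R f + r' *\<^sub>R f" by transfer (simp add: scaleR_add_left)
  show "r *\<^sub>R r' *\<^sub>R f = (r * r') *\<^sub>R f" by transfer simp
  show "1 *\<^sub>R f = f" by transfer simp
  show "sgn f = inverse (norm f) *\<^sub>R f" by (simp add: sgn_dirichlet_h2_def)
  show "dist f g = norm (f - g)" by (simp add: dist_dirichlet_h2_def)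
  show "uniformity = (INF e\<in>{0<..}. principal {(x, y :: dirichlet_h2). dist x y < e})"
    by (simp add: uniformity_dirichlet_h2_def)
  show "open U \<longleftrightarrow> (\<forall>x\<in>U. \<forall>\<^sub>F (x', y) in uniformity. x' = x \<longrightarrow> y \<in> U)"
    for U :: "dirichlet_h2 set"
    by (simp add: open_dirichlet_h2_def)
  have inner_summable: "summable (\<lambda>n. inner (h2_coeff x n) (h2_coeff y n))" for x y
    by (intro summable_inner_sq h2_summable)
  show "inner f g = inner g f"
    by (simp add: inner_dirichlet_h2_def inner_commute)
  show "inner (f + g) h = inner f h + inner g h"
    using suminf_add[OF inner_summable[of f h] inner_summable[of g h]]
    by (simp add: inner_dirichlet_h2_def plus_dirichlet_h2.rep_eq inner_add_left)
  show "inner (r *\<^sub>R f) g = r * inner f g"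
    using suminf_mult[OF inner_summable[of f g], of r]
    by (simp add: inner_dirichlet_h2_def scaleR_dirichlet_h2.rep_eq)
  show "0 \<le> inner f f"
    unfolding inner_dirichlet_h2_def by (intro suminf_nonneg inner_summable) simp
  show "inner f f = 0 \<longleftrightarrow> f = 0"
    unfolding inner_dirichlet_h2_def
    by (subst suminf_eq_zero_iff[OF inner_summable])
       (auto simp: h2_coeff_inject[symmetric] zero_dirichlet_h2.rep_eq)
  show "norm f = sqrt (inner f f)"
    by (simp add: norm_dirichlet_h2_def inner_dirichlet_h2_def power2_norm_eq_inner)
qed

end

lemma norm_dirichlet_h2_sq: "(norm f)\<^sup>2 = (\<Sum>n. (norm (h2_coeff f n))\<^sup>2)"
  unfolding norm_dirichlet_h2_def
  by (intro real_sqrt_pow2 suminf_nonneg h2_summable) simp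

lemma sum_norm_coeff_sq_le: "(\<Sum>n<N. (norm (h2_coeff f n))\<^sup>2) \<le> (norm f)\<^sup>2"
  unfolding norm_dirichlet_h2_sq by (intro sum_le_suminf h2_summable) auto

lemma norm_coeff_le: "norm (h2_coeff f n) \<le> norm f"
proof -
  have "(norm (h2_coeff f n))\<^sup>2 \<le> (\<Sum>k<Suc n. (norm (h2_coeff f k))\<^sup>2)"
    by (simp add: sum_nonneg)
  also have "\<dots> \<le> (norm f)\<^sup>2" by (rule sum_norm_coeff_sq_le)
  finally show ?thesis by (rule power2_le_imp_le) simp
qed

instance dirichlet_h2 :: banach
proof
  fix X :: "nat \<Rightarrow> dirichlet_h2"
  assume X: "Cauchy X"
  have "\<exists>l. (\<lambda>k. h2_coeff (X k) n) \<longlonglongrightarrow> l" for n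
  proof -
    have "Cauchy (\<lambda>k. h2_coeff (X k) n)"
    proof (rule CauchyI)
      fix e :: real assume "e > 0"
      then obtain M where M: "\<And>i j. i \<ge> M \<Longrightarrow> j \<ge> M \<Longrightarrow> norm (X i - X j) < e"
        using CauchyD[OF X] by blast
      have "norm (h2_coeff (X i) n - h2_coeff (X j) n) < e" if "i \<ge> M" "j \<ge> M" for i j
        using le_less_trans[OF norm_coeff_le[of "X i - X j" n] M[OF that]]
        by (simp add: minus_dirichlet_h2.rep_eq)
      then show "\<exists>M. \<forall>i\<ge>M. \<forall>j\<ge>M. norm (h2_coeff (X i) n - h2_coeff (X j) n) < e"
        by blast
    qed
    then show ?thesis
      using Cauchy_convergent convergent_def by blast
  qed
  then obtain a where a: "\<And>n. (\<lambda>k. h2_coeff (X k) n) \<longlonglongrightarrow> a n" by metis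
  have a0: "a 0 = 0" using a[of 0] by (simp add: LIMSEQ_const_iff)
  have tail: "\<exists>M. \<forall>i\<ge>M. \<forall>N. (\<Sum>n<N. (norm (h2_coeff (X i) n - a n))\<^sup>2) \<le> e\<^sup>2" if "e > 0" for e :: real
  proof -
    obtain M where M: "\<And>i j. i \<ge> M \<Longrightarrow> j \<ge> M \<Longrightarrow> norm (X i - X j) < e"
      using CauchyD[OF X \<open>e > 0\<close>] by blast
    have "(\<Sum>n<N. (norm (h2_coeff (X i) n - a n))\<^sup>2) \<le> e\<^sup>2" if i: "i \<ge> M" for i N
    proof (rule tendsto_upperbound)
      show "(\<lambda>j. \<Sum>n<N. (norm (h2_coeff (X i) n - h2_coeff (X j) n))\<^sup>2)
              \<longlonglongrightarrow> (\<Sum>n<N. (norm (h2_coeff (X i) n - a n))\<^sup>2)"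
        by (intro tendsto_intros a)
      have "(\<Sum>n<N. (norm (h2_coeff (X i) n - h2_coeff (X j) n))\<^sup>2) \<le> e\<^sup>2" if "j \<ge> M" for j
      proof -
        have "(\<Sum>n<N. (norm (h2_coeff (X i) n - h2_coeff (X j) n))\<^sup>2) \<le> (norm (X i - X j))\<^sup>2"
          using sum_norm_coeff_sq_le[of "X i - X j" N] by (simp add: minus_dirichlet_h2.rep_eq)
        also have "\<dots> \<le> e\<^sup>2"
          using M[OF i that] by (intro power_mono) auto
        finally show ?thesis .
      qed
      then show "\<forall>\<^sub>F j in sequentially.
          (\<Sum>n<N. (norm (h2_coeff (X i) n - h2_coeff (X j) n))\<^sup>2) \<le> e\<^sup>2"
        by (auto simp: eventually_sequentially)
    qed simp
    then show ?thesis by blast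
  qed
  obtain M where M: "\<And>i N. i \<ge> M \<Longrightarrow> (\<Sum>n<N. (norm (h2_coeff (X i) n - a n))\<^sup>2) \<le> 1"
    using tail[of 1] by auto
  have "summable (\<lambda>n. (norm (h2_coeff (X M) n - a n))\<^sup>2)"
    by (rule bounded_imp_summable[where B = 1])
       (simp_all only: zero_le_power2 M[OF order_refl] flip: lessThan_Suc_atMost)
  then have "summable (\<lambda>n. (norm (a n - h2_coeff (X M) n + h2_coeff (X M) n))\<^sup>2)"
    by (intro summable_norm_add_sq h2_summable) (simp add: norm_minus_commute)
  with a0 have "a \<in> {a. a 0 = 0 \<and> summable (\<lambda>n. (norm (a n))\<^sup>2)}" by simp
  then have L: "h2_coeff (Abs_dirichlet_h2 a) = a" by (rule Abs_dirichlet_h2_inverse)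
  have "X \<longlonglongrightarrow> Abs_dirichlet_h2 a"
  proof (rule LIMSEQ_I)
    fix e :: real assume "e > 0"
    then obtain M where M: "\<And>i N. i \<ge> M \<Longrightarrow> (\<Sum>n<N. (norm (h2_coeff (X i) n - a n))\<^sup>2) \<le> (e/2)\<^sup>2"
      using tail[of "e/2"] by auto
    have "norm (X i - Abs_dirichlet_h2 a) < e" if "i \<ge> M" for i
    proof -
      have "(norm (X i - Abs_dirichlet_h2 a))\<^sup>2 \<le> (e/2)\<^sup>2"
        unfolding norm_dirichlet_h2_sq
        by (rule suminf_le_const[OF h2_summable])
           (use M[OF that] in \<open>simp add: minus_dirichlet_h2.rep_eq L\<close>)
      then have "norm (X i - Abs_dirichlet_h2 a) \<le> e/2"
        by (rule power2_le_imp_le) (use \<open>e > 0\<close> in simp)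
      then show ?thesis using \<open>e > 0\<close> by simp
    qed
    then show "\<exists>M. \<forall>i\<ge>M. norm (X i - Abs_dirichlet_h2 a) < e" by blast
  qed
  then show "convergent X" by (auto simp: convergent_def)
qed


section \<open>The Gordon--Hedenmalm class\<close>

text \<open>
  The symbol is required to agree with \<open>c\<^sub>0 s + \<phi>\<^sub>0(s)\<close> on its domain \<open>Re s > 1/2\<close> only; the
  conditions on \<open>Re s > 0\<close> concern the sum \<open>\<phi>\<^sub>0\<close> of the Dirichlet series itself.
\<close>
definition gordon_hedenmalm_with_characteristic :: "nat \<Rightarrow> (complex \<Rightarrow> complex) set"
  where "gordon_hedenmalm_with_characteristic c\<^sub>0 =
    {\<phi>. \<phi> ` right_halfplane (1/2) \<subseteq> right_halfplane (1/2) \<and>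
        (\<exists>c. (\<forall>s\<in>right_halfplane (1/2). \<phi> s = of_nat c\<^sub>0 * s + dirichlet_series c s) \<and>
             (\<forall>\<epsilon>>0. uniform_limit (right_halfplane \<epsilon>)
                (\<lambda>N s. \<Sum>n=1..N. c n * of_nat n powr (- s)) (dirichlet_series c) sequentially) \<and>
             (c\<^sub>0 = 0 \<longrightarrow> dirichlet_series c ` right_halfplane 0 \<subseteq> right_halfplane (1/2)) \<and>
             (c\<^sub>0 \<ge> 1 \<longrightarrow> (\<forall>s\<in>right_halfplane 0. dirichlet_series c s = 0) \<or>
                dirichlet_series c ` right_halfplane 0 \<subseteq> right_halfplane 0))}"

definition gordon_hedenmalm :: "(complex \<Rightarrow> complex) set"
  where "gordon_hedenmalm = (\<Union>c\<^sub>0. gordon_hedenmalm_with_characteristic c\<^sub>0)"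

definition unrestricted_range :: "(complex \<Rightarrow> complex) \<Rightarrow> bool"
  where "unrestricted_range \<phi> \<longleftrightarrow> (INF s\<in>right_halfplane 0. Re (\<phi> s)) = 1/2"

abbreviation restricted_range :: "(complex \<Rightarrow> complex) \<Rightarrow> bool"
  where "restricted_range \<phi> \<equiv> \<not> unrestricted_range \<phi>"


section \<open>Composition operators and compactness\<close>

definition compact_operator ::
    "('a::real_normed_vector \<Rightarrow> 'b::real_normed_vector) \<Rightarrow> bool"
  where "compact_operator T \<longleftrightarrow> bounded_linear T \<and> compact (closure (T ` cball 0 1))"

text \<open>
  \<open>T\<close> is the operator \<open>f \<mapsto> f \<circ> \<phi>\<close>. Since a Dirichlet series is determined by its values, there
  is at most one such \<open>T\<close>, and it is automatically complex linear; so real linearity in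
  \<open>compact_operator\<close> loses nothing.
\<close>
definition is_composition_operator ::
    "(complex \<Rightarrow> complex) \<Rightarrow> (dirichlet_h2 \<Rightarrow> dirichlet_h2) \<Rightarrow> bool"
  where "is_composition_operator \<phi> T \<longleftrightarrow>
    (\<forall>f. \<forall>s\<in>right_halfplane (1/2). h2_eval (T f) s = h2_eval f (\<phi> s))"

definition compact_composition_operator :: "(complex \<Rightarrow> complex) \<Rightarrow> bool"
  where "compact_composition_operator \<phi> \<longleftrightarrow>
    (\<exists>T. is_composition_operator \<phi> T \<and> compact_operator T)"


section \<open>Linear independence of logarithms over the rationals\<close>

interpretation rat_real: vector_space "\<lambda>(r::rat) (x::real). of_rat r * x"
  by unfold_locales (auto simp: algebra_simps of_rat_add of_rat_mult)

definition rat_independent_integers :: "nat set \<Rightarrow> bool"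
  where "rat_independent_integers \<Lambda> \<longleftrightarrow>
    \<Lambda> \<subseteq> {2..} \<and> rat_real.independent ((\<lambda>n. ln (real n)) ` \<Lambda>)"

end

theory Submission
  imports Defs "HOL-Complex_Analysis.Complex_Analysis"
begin

text \<open>
  Write \<open>m\<^sub>j\<close> for the minimum of \<open>Re P\<^sub>j\<close> on the unit circle. By Kronecker's theorem the infimum of
  \<open>Re \<phi>\<close> is \<open>\<Sum>j. m\<^sub>j\<close>, so the range is unrestricted iff this sum equals \<open>1/2\<close>.

  In one variable, \<open>\<bar>\<Sum>n. a\<^sub>n n powr - P z\<bar>\<^sup>2\<close> is dominated by an explicit function that is harmonic
  in \<open>z\<close>, because \<open>min n m powr (2 x)\<close> is a positive definite kernel; evaluating its mean at the
  origin with the Schur test bounds the \<open>\<ell>\<^sup>2\<close> norm of the Taylor coefficients by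
  \<open>C * (\<Sum>n. \<bar>a\<^sub>n\<bar>\<^sup>2 n powr (1 - 2 m\<^sub>1))\<close>. Each further variable multiplies the weight of \<open>\<bar>a\<^sub>n\<bar>\<^sup>2\<close> by the
  circle mean of \<open>n powr (- 2 Re P\<^sub>j)\<close>, which is \<open>o(n powr (- 2 m\<^sub>j))\<close>. Hence the weights tend to
  zero, and the operator is a norm limit of finite rank operators, as soon as \<open>\<Sum>j. m\<^sub>j > 1/2\<close> or
  \<open>d \<ge> 2\<close>. For \<open>d = 1\<close> and \<open>m\<^sub>1 = 1/2\<close>, reproducing kernels at \<open>P ((1 - \<epsilon>) z\<^sub>0)\<close>, where \<open>Re P\<close> is
  minimal at \<open>z\<^sub>0\<close>, show that it is not compact.
\<close>

section \<open>Taylor coefficients of entire functions\<close>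

text \<open>With \<open>x = Re s\<close>, the product of \<open>n powr (- s)\<close> and the
  conjugate of \<open>m powr (- s)\<close> has modulus \<open>(n * m) powr (- x)\<close>;
  multiplying by \<open>min n m powr (2 * x)\<close> leaves a power of
  \<open>max n m / min n m\<close> that is holomorphic or antiholomorphic in s. For
  \<open>x \<ge> 0\<close> the kernel stays positive semidefinite after 1 is subtracted, so the
  factor does not decrease the quadratic form. This is why a lower bound of Re P is subtracted
  first: a single minimum may lie below 1/2 or be negative, as only the sum is constrained. At the
  origin Re P strictly exceeds that bound, which makes the matrix decay. The Schur test costs a
  factor n, paid in one variable only; in the others Parseval for a single
  \<open>n powr - P z\<close> suffices. Q-independence serves twice: monomials in the
  \<open>q j\<close> are distinct integers, so the coefficients separate the variables, and
  Kronecker's theorem applies. In the negative direction, \<open>(1 - \<epsilon>) z\<^sub>0\<close>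
  corresponds for small \<epsilon> to a real part near 0, where series in the space need not
  converge; hence the image is compared with Taylor coefficients, not evaluated.\<close>

definition taylor_coeff :: "(complex \<Rightarrow> complex) \<Rightarrow> nat \<Rightarrow> complex"
  where "taylor_coeff F k = (deriv ^^ k) F 0 / fact k"

definition circle_point :: "real \<Rightarrow> complex"
  where "circle_point t = exp (2 * of_real pi * \<i> * of_real t)"

lemma norm_circle_point [simp]: "norm (circle_point t) = 1"
  by (simp add: circle_point_def norm_exp_eq_Re)

lemma circle_point_nonzero [simp]: "circle_point t \<noteq> 0"
  by (simp add: circle_point_def)

lemma continuous_on_circle_point [continuous_intros]: "continuous_on S circle_point"
  unfolding circle_point_def by (intro continuous_intros)

lemma taylor_coeff_sums:
  assumes "F holomorphic_on UNIV"
  shows "(\<lambda>k. taylor_coeff F k * z ^ k) sums F z"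
  using holomorphic_power_series[of F 0 "norm z + 1" z] assms
  by (simp add: taylor_coeff_def holomorphic_on_subset)

lemma summable_norm_taylor_coeff:
  assumes "F holomorphic_on UNIV"
  shows "summable (\<lambda>k. norm (taylor_coeff F k))"
  using powser_insidea[OF sums_summable[OF taylor_coeff_sums[OF assms, of 2]], of 1] by simp

text \<open>Cauchy's formula on the unit circle. Since 1 / z is the conjugate of z there, Taylor
  coefficients become Fourier coefficients.\<close>

lemma taylor_coeff_has_integral:
  assumes "F holomorphic_on UNIV"
  shows "((\<lambda>t. F (circle_point t) * cnj (circle_point t) ^ k) has_integral taylor_coeff F k) {0..1}"
proof -
  have "((\<lambda>u. F u / (u - 0) ^ Suc k) has_contour_integral
      ((2 * pi * \<i>) / fact k * (deriv ^^ k) F 0)) (circlepath 0 1)"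
    using assms by (intro Cauchy_has_contour_integral_higher_derivative_circlepath)
      (auto intro: holomorphic_on_imp_continuous_on holomorphic_on_subset)
  then have I: "((\<lambda>x. F (circlepath 0 1 x) / (circlepath 0 1 x) ^ Suc k * vector_derivative (circlepath 0 1) (at x within {0..1}))
      has_integral ((2 * pi * \<i>) / fact k * (deriv ^^ k) F 0)) {0..1}"
    unfolding has_contour_integral_def by simp
  have eq: "F (circlepath 0 1 x) / (circlepath 0 1 x) ^ Suc k * vector_derivative (circlepath 0 1) (at x within {0..1})
      = (2 * pi * \<i>) * (F (circle_point x) * cnj (circle_point x) ^ k)" if "x \<in> {0..1}" for x
  proof -
    have "circle_point x * cnj (circle_point x) = 1"
      by (metis complex_norm_square norm_circle_point of_real_1 one_power2)
    then have 1: "circle_point x ^ k * cnj (circle_point x) ^ k = 1"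
      by (metis power_mult_distrib power_one)
    have "vector_derivative (circlepath 0 1) (at x within {0..1}) = 2 * pi * \<i> * circle_point x"
      using that by (simp add: vector_derivative_circlepath01 circle_point_def)
    moreover have "circlepath 0 1 x = circle_point x"
      by (simp add: circlepath circle_point_def)
    ultimately show ?thesis
      using 1 by (auto simp: divide_simps mult.commute)
  qed
  have "((\<lambda>x. (2 * pi * \<i>) * (F (circle_point x) * cnj (circle_point x) ^ k))
      has_integral ((2 * pi * \<i>) / fact k * (deriv ^^ k) F 0)) {0..1}"
    by (rule has_integral_eq[OF eq I])
  from has_integral_mult_right[OF this, of "inverse (2 * pi * \<i>)"] show ?thesis
    by (simp add: taylor_coeff_def field_simps)
qed

lemma mean_value_has_integral:
  assumes "F holomorphic_on UNIV"
  shows "((\<lambda>t. F (circle_point t)) has_integral F 0) {0..1}"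
  using taylor_coeff_has_integral[OF assms, of 0] by (simp add: taylor_coeff_def)

text \<open>Linearity is read off from the integral formula, which avoids iterated derivatives of
  sums.\<close>

lemma taylor_coeff_sum:
  assumes "\<And>n. n \<in> S \<Longrightarrow> F n holomorphic_on UNIV" "finite S"
  shows "taylor_coeff (\<lambda>z. \<Sum>n\<in>S. a n * F n z) k = (\<Sum>n\<in>S. a n * taylor_coeff (F n) k)"
proof (rule has_integral_unique)
  show "((\<lambda>t. (\<Sum>n\<in>S. a n * F n (circle_point t)) * cnj (circle_point t) ^ k)
      has_integral taylor_coeff (\<lambda>z. \<Sum>n\<in>S. a n * F n z) k) {0..1}"
    by (intro taylor_coeff_has_integral holomorphic_intros assms)
  have "((\<lambda>t. \<Sum>n\<in>S. a n * (F n (circle_point t) * cnj (circle_point t) ^ k))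
      has_integral (\<Sum>n\<in>S. a n * taylor_coeff (F n) k)) {0..1}"
    by (intro has_integral_sum has_integral_mult_right taylor_coeff_has_integral assms)
  then show "((\<lambda>t. (\<Sum>n\<in>S. a n * F n (circle_point t)) * cnj (circle_point t) ^ k)
      has_integral (\<Sum>n\<in>S. a n * taylor_coeff (F n) k)) {0..1}"
    by (simp add: sum_distrib_right mult.assoc)
qed

text \<open>The Taylor coefficients are absolutely summable, so the partial sums converge uniformly
  on the circle. Integrating F against their conjugates gives the partial sums of the left-hand
  series.\<close>

lemma parseval_sums:
  assumes "F holomorphic_on UNIV"
  shows "(\<lambda>k. (norm (taylor_coeff F k))\<^sup>2) sums integral {0..1} (\<lambda>t. (norm (F (circle_point t)))\<^sup>2)"
proof -
  define c where "c = taylor_coeff F"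
  have cF: "continuous_on {0..1} (\<lambda>t. F (circle_point t))"
    by (rule continuous_on_compose2[OF holomorphic_on_imp_continuous_on[OF assms]])
       (auto intro: continuous_on_circle_point)
  have u1: "uniform_limit {0..1} (\<lambda>K t. \<Sum>k<K. c k * circle_point t ^ k)
      (\<lambda>t. \<Sum>k. c k * circle_point t ^ k) sequentially"
    by (rule Weierstrass_m_test[where M = "\<lambda>k. norm (c k)"])
       (auto simp: norm_mult norm_power c_def summable_norm_taylor_coeff[OF assms])
  have eqF: "(\<Sum>k. c k * circle_point t ^ k) = F (circle_point t)" for t
    using taylor_coeff_sums[OF assms] sums_unique c_def by metis
  have bF: "bounded ((\<lambda>t. F (circle_point t)) ` {0..1})"
    by (intro compact_imp_bounded compact_continuous_image cF) auto
  have "uniform_limit {0..1} (\<lambda>K t. cnj (\<Sum>k<K. c k * circle_point t ^ k)) (\<lambda>t. cnj (F (circle_point t))) sequentially"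
    using bounded_linear.uniform_limit[OF bounded_linear_cnj u1] unfolding eqF by simp
  then have "uniform_limit {0..1} (\<lambda>K t. F (circle_point t) * cnj (\<Sum>k<K. c k * circle_point t ^ k))
      (\<lambda>t. F (circle_point t) * cnj (F (circle_point t))) sequentially"
    using bF by (intro uniform_lim_mult uniform_limit_const) 
      (auto simp: bounded_iff)
  then obtain I J where I: "\<And>K. ((\<lambda>t. F (circle_point t) * cnj (\<Sum>k<K. c k * circle_point t ^ k)) has_integral I K) {0..1}"
    and J: "((\<lambda>t. F (circle_point t) * cnj (F (circle_point t))) has_integral J) {0..1}"
    and IJ: "I \<longlonglongrightarrow> J"
    by (rule uniform_limit_integral) (auto intro!: continuous_intros cF)
  have "I K = of_real (\<Sum>k<K. (norm (c k))\<^sup>2)" for K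
  proof (rule has_integral_unique[OF I])
    have "((\<lambda>t. \<Sum>k<K. cnj (c k) * (F (circle_point t) * cnj (circle_point t) ^ k)) has_integral
        (\<Sum>k<K. cnj (c k) * c k)) {0..1}"
      unfolding c_def by (intro has_integral_sum has_integral_mult_right taylor_coeff_has_integral assms) auto
    moreover have "cnj (c k) * c k = of_real ((norm (c k))\<^sup>2)" for k
      by (metis complex_norm_square mult.commute)
    ultimately show "((\<lambda>t. F (circle_point t) * cnj (\<Sum>k<K. c k * circle_point t ^ k)) has_integral
        of_real (\<Sum>k<K. (norm (c k))\<^sup>2)) {0..1}"
      by (simp add: sum_distrib_left mult_ac)
  qed
  then have "I = (\<lambda>K. of_real (\<Sum>k<K. (norm (c k))\<^sup>2))"
    by (rule ext)
  with IJ have "(\<lambda>K. complex_of_real (\<Sum>k<K. (norm (c k))\<^sup>2)) \<longlonglongrightarrow> J"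
    by simp
  from tendsto_Re[OF this] have *: "(\<lambda>K. \<Sum>k<K. (norm (c k))\<^sup>2) \<longlonglongrightarrow> Re J" by simp
  have "((\<lambda>t. (norm (F (circle_point t)))\<^sup>2) has_integral Re J) {0..1}"
    using has_integral_Re[OF J] by (simp add: complex_norm_square[symmetric] del: of_real_power)
  with * show ?thesis
    unfolding sums_def c_def by (simp add: integral_unique)
qed

lemma bessel_inequality:
  assumes "F holomorphic_on UNIV"
  shows "(\<Sum>k<K. (norm (taylor_coeff F k))\<^sup>2) \<le> integral {0..1} (\<lambda>t. (norm (F (circle_point t)))\<^sup>2)"
proof -
  have "(\<Sum>k<K. (norm (taylor_coeff F k))\<^sup>2) \<le> (\<Sum>k. (norm (taylor_coeff F k))\<^sup>2)"
    by (intro sum_le_suminf sums_summable[OF parseval_sums[OF assms]]) auto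
  then show ?thesis using parseval_sums[OF assms] by (simp add: sums_iff)
qed

section \<open>A positive definite kernel and the Schur test\<close>

text \<open>The sum telescopes down to \<open>0 powr y\<close>, which is 0 for every y, including
  \<open>y = 0\<close>. In particular the increment at \<open>k = 1\<close> is always 1.\<close>

lemma sum_powr_diff:
  "(\<Sum>k=1..j. real k powr y - real (k - 1) powr y) = real j powr y"
  by (induction j) auto

text \<open>Writing the kernel as the sum of the increments over all k below both n and m makes it a
  combination of rank one kernels, and the quadratic form a weighted sum of squared tails.\<close>

lemma min_kernel_sum:
  fixes e :: "nat \<Rightarrow> complex"
  shows "(\<Sum>n=1..N. \<Sum>m=1..N. e n * cnj (e m) * of_real (real (min n m) powr y)) =
    of_real (\<Sum>k=1..N. (real k powr y - real (k - 1) powr y) * (norm (\<Sum>n=k..N. e n))\<^sup>2)"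
proof -
  define D where "D k = real k powr y - real (k - 1) powr y" for k :: nat
  have 1: "real (min n m) powr y = (\<Sum>k=1..N. D k * of_bool (k \<le> n) * of_bool (k \<le> m))"
    if "n \<in> {1..N}" "m \<in> {1..N}" for n m
  proof -
    have "(\<Sum>k=1..N. D k * of_bool (k \<le> n) * of_bool (k \<le> m)) = (\<Sum>k=1..min n m. D k)"
      using that by (intro sum.mono_neutral_cong_right) auto
    then show ?thesis unfolding D_def sum_powr_diff by simp
  qed
  have 2: "(\<Sum>n=1..N. e n * of_bool (k \<le> n)) = (\<Sum>n=k..N. e n)" if "k \<in> {1..N}" for k
    using that by (intro sum.mono_neutral_cong_right) auto
  have "(\<Sum>n=1..N. \<Sum>m=1..N. e n * cnj (e m) * of_real (real (min n m) powr y)) =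
    (\<Sum>n=1..N. \<Sum>m=1..N. \<Sum>k=1..N. of_real (D k) * (e n * of_bool (k \<le> n)) * (cnj (e m * of_bool (k \<le> m))))"
    by (intro sum.cong refl) (auto simp: 1 sum_distrib_left mult_ac intro!: sum.cong)
  also have "\<dots> = (\<Sum>n=1..N. \<Sum>k=1..N. \<Sum>m=1..N. of_real (D k) * (e n * of_bool (k \<le> n)) * (cnj (e m * of_bool (k \<le> m))))"
    by (intro sum.cong refl sum.swap)
  also have "\<dots> = (\<Sum>k=1..N. \<Sum>n=1..N. \<Sum>m=1..N. of_real (D k) * (e n * of_bool (k \<le> n)) * (cnj (e m * of_bool (k \<le> m))))"
    by (rule sum.swap)
  also have "\<dots> = (\<Sum>k=1..N. of_real (D k) * ((\<Sum>n=1..N. e n * of_bool (k \<le> n)) * cnj (\<Sum>n=1..N. e n * of_bool (k \<le> n))))"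
    by (simp only: cnj_sum sum_product) (simp only: sum_distrib_left mult.assoc)
  also have "\<dots> = (\<Sum>k=1..N. of_real (D k) * ((\<Sum>n=k..N. e n) * cnj (\<Sum>n=k..N. e n)))"
    by (intro sum.cong refl) (simp only: 2)
  also have "\<dots> = of_real (\<Sum>k=1..N. D k * (norm (\<Sum>n=k..N. e n))\<^sup>2)"
    by (simp only: complex_norm_square[symmetric] of_real_sum of_real_mult)
  finally show ?thesis unfolding D_def .
qed

text \<open>This is n / m to the power -s, or its conjugate with n and m exchanged: a Hermitian
  matrix with entries harmonic in s. The order of n and m is chosen so that the entries do not
  exceed 1 in modulus when \<open>Re s \<ge> 0\<close>.\<close>

definition cross_power :: "nat \<Rightarrow> nat \<Rightarrow> complex \<Rightarrow> complex"
  where "cross_power n m s =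
    (if m \<le> n then exp (- s * of_real (ln n - ln m)) else cnj (exp (- s * of_real (ln m - ln n))))"

lemma of_nat_powr: "n > 0 \<Longrightarrow> of_nat n powr (z :: complex) = exp (z * of_real (ln n))"
  by (simp add: powr_def flip: Ln_of_nat)

lemma norm_of_nat_powr: "norm (of_nat n powr (z :: complex)) = real n powr Re z"
  by (cases "n = 0") (auto simp: of_nat_powr powr_def mult.commute)

lemma cross_power_eq:
  assumes "n > 0" "m > 0"
  shows "cross_power n m (Complex x y) = of_nat n powr (- Complex x y) * cnj (of_nat m powr (- Complex x y))
    * of_real (real (min n m) powr (2 * x))"
proof -
  have "ln (real m) \<le> ln (real n) \<longleftrightarrow> m \<le> n" using assms by simp
  then show ?thesis using assms
    by (simp add: cross_power_def of_nat_powr powr_def exp_cnj Complex_eq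
        algebra_simps min_def flip: exp_add exp_of_real)
qed

lemma norm_cross_power:
  assumes "n > 0" "m > 0"
  shows "norm (cross_power n m s) = (real (max n m) / real (min n m)) powr (- Re s)"
  using assms by (auto simp: cross_power_def norm_exp_eq_Re powr_def ln_div max_def min_def)

text \<open>The left-hand side is the term \<open>k = 1\<close> of the sum of squares in
  \<open>min_kernel_sum\<close>, whose weight is 1. The other weights are nonnegative because
  \<open>Re s \<ge> 0\<close>.\<close>

lemma norm_dirichlet_polynomial_le_cross:
  assumes "Re s \<ge> 0"
  shows "(norm (\<Sum>n=1..N. b n * of_nat n powr (- s)))\<^sup>2 \<le>
    Re (\<Sum>n=1..N. \<Sum>m=1..N. b n * cnj (b m) * cross_power n m s)"
proof -
  define x where "x = Re s"
  define e where "e n = b n * of_nat n powr (- s)" for n :: nat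
  define D where "D k = real k powr (2 * x) - real (k - 1) powr (2 * x)" for k :: nat
  have D: "D k \<ge> 0" for k unfolding D_def using assms
    by (auto simp: x_def intro!: powr_mono2)
  have "(norm (\<Sum>n=1..N. e n))\<^sup>2 \<le> (\<Sum>k=1..N. D k * (norm (\<Sum>n=k..N. e n))\<^sup>2)"
  proof (cases "N = 0")
    case False
    have "(norm (\<Sum>n=1..N. e n))\<^sup>2 = (\<Sum>k\<in>{1}. D k * (norm (\<Sum>n=k..N. e n))\<^sup>2)"
      by (simp add: D_def)
    also have "\<dots> \<le> (\<Sum>k=1..N. D k * (norm (\<Sum>n=k..N. e n))\<^sup>2)"
      using False D by (intro sum_mono2) auto
    finally show ?thesis .
  qed simp
  also have "\<dots> = Re (\<Sum>n=1..N. \<Sum>m=1..N. e n * cnj (e m) * of_real (real (min n m) powr (2 * x)))"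
    unfolding min_kernel_sum D_def by simp
  also have "(\<Sum>n=1..N. \<Sum>m=1..N. e n * cnj (e m) * of_real (real (min n m) powr (2 * x))) =
      (\<Sum>n=1..N. \<Sum>m=1..N. b n * cnj (b m) * cross_power n m s)"
    by (intro sum.cong refl) (use cross_power_eq[of _ _ "Re s" "Im s"] in \<open>auto simp: e_def x_def mult_ac\<close>)
  finally show ?thesis unfolding e_def .
qed

section \<open>Row sums of the matrix \<open>(max / min) powr (- \<delta>)\<close> and the Schur
  test\<close>

lemma powr_diff_ge:
  fixes a b p :: real
  assumes "0 < a" "a \<le> b" "p \<le> 1" "0 \<le> p"
  shows "p * b powr (p - 1) * (b - a) \<le> b powr p - a powr p"
proof (cases "a = b")
  case False
  then have "\<exists>z>a. z < b \<and> b powr p - a powr p = (b - a) * (p * z powr (p - 1))"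
    using assms by (intro MVT2) (auto intro!: derivative_eq_intros)
  then obtain z where z: "a < z" "z < b" "b powr p - a powr p = (b - a) * (p * z powr (p - 1))"
    by blast
  have "b powr (p - 1) \<le> z powr (p - 1)"
    using z assms by (intro powr_mono2') auto
  then show ?thesis using z assms by (simp add: mult_left_mono mult.commute)
qed simp

lemma powr_minus_diff_ge:
  fixes a b p :: real
  assumes "0 < a" "a \<le> b" "0 \<le> p"
  shows "p * b powr (- p - 1) * (b - a) \<le> a powr (- p) - b powr (- p)"
proof (cases "a = b")
  case False
  then have "\<exists>z>a. z < b \<and> b powr (-p) - a powr (-p) = (b - a) * (- p * z powr (- p - 1))"
    using assms by (intro MVT2) (auto intro!: derivative_eq_intros)
  then obtain z where z: "a < z" "z < b" "b powr (-p) - a powr (-p) = (b - a) * (- p * z powr (- p - 1))"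
    by blast
  have "b powr (- p - 1) \<le> z powr (- p - 1)"
    using z assms by (intro powr_mono2') auto
  then have "(b - a) * (p * b powr (- p - 1)) \<le> (b - a) * (p * z powr (- p - 1))"
    using assms by (intro mult_left_mono) auto
  then show ?thesis using z by (simp add: mult_ac)
qed simp

lemma sum_powr_le:
  assumes "0 < \<delta>" "\<delta> \<le> 1"
  shows "(\<Sum>m=1..n. \<delta> * real m powr (\<delta> - 1)) \<le> real n powr \<delta>"
proof (induction n)
  case (Suc n)
  have "\<delta> * real (Suc n) powr (\<delta> - 1) \<le> real (Suc n) powr \<delta> - real n powr \<delta>"
    using powr_diff_ge[of "real n" "real (Suc n)" \<delta>] assms by (cases "n = 0") auto
  with Suc show ?case by simp
qed simp

lemma sum_powr_tail_le:
  assumes "0 < \<delta>" "n > 0" "n \<le> N"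
  shows "(\<Sum>m=Suc n..N. \<delta> * real m powr (- \<delta> - 1)) \<le> real n powr (- \<delta>) - real N powr (- \<delta>)"
  using assms(3)
proof (induction N rule: dec_induct)
  case (step N)
  have "\<delta> * real (Suc N) powr (- \<delta> - 1) \<le> real N powr (- \<delta>) - real (Suc N) powr (- \<delta>)"
    using powr_minus_diff_ge[of "real N" "real (Suc N)" \<delta>] assms step by auto
  with step show ?case by simp
qed simp

text \<open>The row is cut at \<open>m = n\<close>. Below, it is \<open>n powr (- \<delta>)\<close>
  times a sum of \<open>m powr (\<delta> - 1)\<close>; above, \<open>n powr \<delta>\<close> times a
  sum of \<open>m powr (- \<delta> - 1)\<close>. Each part is at most \<open>1 / \<delta>\<close> by
  telescoping.\<close>

lemma schur_row_sum:
  assumes "0 < \<delta>" "\<delta> \<le> 1" "n > 0"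
  shows "(\<Sum>m=1..N. (real (max n m) / real (min n m)) powr (- \<delta>) / real m) \<le> 2 / \<delta>"
proof -
  define g where "g m = (real (max n m) / real (min n m)) powr (- \<delta>) / real m" for m
  \<comment> \<open>The range is enlarged to contain n, so that the cut at n makes sense also when
    \<open>N < n\<close>.\<close>
  define M where "M = max n N"
  have "(\<Sum>m=1..N. g m) \<le> (\<Sum>m=1..M. g m)"
    by (intro sum_mono2) (auto simp: M_def g_def)
  also have "{1..M} = {1..n} \<union> {Suc n..M}" using assms by (auto simp: M_def)
  also have "(\<Sum>m\<in>{1..n} \<union> {Suc n..M}. g m) = (\<Sum>m=1..n. g m) + (\<Sum>m=Suc n..M. g m)"
    by (intro sum.union_disjoint) auto
  also have "(\<Sum>m=1..n. g m) = (real n powr (- \<delta>) / \<delta>) * (\<Sum>m=1..n. \<delta> * real m powr (\<delta> - 1))"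
    unfolding sum_distrib_left using assms
    by (intro sum.cong refl) (auto simp: g_def max_def min_def powr_divide powr_diff powr_minus field_simps)
  also have "\<dots> \<le> (real n powr (- \<delta>) / \<delta>) * real n powr \<delta>"
    using assms by (intro mult_left_mono sum_powr_le) auto
  also have "\<dots> = 1 / \<delta>" using assms by (simp add: powr_minus)
  also have "(\<Sum>m=Suc n..M. g m) = (real n powr \<delta> / \<delta>) * (\<Sum>m=Suc n..M. \<delta> * real m powr (- \<delta> - 1))"
    unfolding sum_distrib_left using assms
    by (intro sum.cong refl) (auto simp: g_def max_def min_def powr_divide powr_diff powr_minus field_simps)
  also have "\<dots> \<le> (real n powr \<delta> / \<delta>) * (real n powr (- \<delta>) - real M powr (- \<delta>))"
    using assms by (intro mult_left_mono sum_powr_tail_le) (auto simp: M_def)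
  also have "\<dots> \<le> (real n powr \<delta> / \<delta>) * real n powr (- \<delta>)"
    using assms by (intro mult_left_mono) auto
  also have "\<dots> = 1 / \<delta>" using assms by (simp add: powr_minus)
  finally show ?thesis unfolding g_def by simp
qed

text \<open>Expanding the square of \<open>b n * n - b m * m\<close> bounds
  \<open>2 * b n * b m\<close> by two terms with weights n / m and m / n. By symmetry of the kernel
  both lead to the row sums above.\<close>

lemma schur_test_le:
  assumes "0 < \<delta>" "\<delta> \<le> 1" and b: "\<And>n. b n \<ge> 0"
  shows "(\<Sum>n=1..N. \<Sum>m=1..N. b n * b m * (real (max n m) / real (min n m)) powr (- \<delta>))
    \<le> 2 / \<delta> * (\<Sum>n=1..N. real n * (b n)\<^sup>2)"
proof -
  define K where "K n m = (real (max n m) / real (min n m)) powr (- \<delta>)" for n m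
  have half: "(x + x) / 2 = x" for x :: real by simp
  have K: "K n m = K m n" "K n m \<ge> 0" for n m by (auto simp: K_def max.commute min.commute)
  have "b n * b m * K n m \<le> ((b n)\<^sup>2 * n * (K n m / m) + (b m)\<^sup>2 * m * (K m n / n)) / 2"
    if "n \<in> {1..N}" "m \<in> {1..N}" for n m
  proof -
    have n: "real n > 0" "real m > 0" using that by auto
    have "b n * b m * 2 \<le> (b n)\<^sup>2 * n / m + (b m)\<^sup>2 * m / n"
    proof -
      have "0 \<le> (b n * n - b m * m)\<^sup>2 / (real n * real m)" by simp
      also have "\<dots> = (b n)\<^sup>2 * n / m + (b m)\<^sup>2 * m / n - b n * b m * 2"
        using n by (simp add: power2_eq_square field_simps)
      finally show ?thesis by simp
    qed
    from mult_right_mono[OF this K(2)[of n m]] show ?thesis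
      by (simp add: K(1)[of m n] algebra_simps)
  qed
  then have "(\<Sum>n=1..N. \<Sum>m=1..N. b n * b m * K n m) \<le>
      (\<Sum>n=1..N. \<Sum>m=1..N. ((b n)\<^sup>2 * n * (K n m / m) + (b m)\<^sup>2 * m * (K m n / n)) / 2)"
    by (intro sum_mono)
  also have "\<dots> = ((\<Sum>n=1..N. \<Sum>m=1..N. (b n)\<^sup>2 * n * (K n m / m)) + (\<Sum>n=1..N. \<Sum>m=1..N. (b m)\<^sup>2 * m * (K m n / n))) / 2"
    by (simp add: sum.distrib flip: sum_divide_distrib)
  also have "(\<Sum>n=1..N. \<Sum>m=1..N. (b m)\<^sup>2 * m * (K m n / n)) = (\<Sum>n=1..N. \<Sum>m=1..N. (b n)\<^sup>2 * n * (K n m / m))"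
    by (rule sum.swap)
  also have "((\<Sum>n=1..N. \<Sum>m=1..N. (b n)\<^sup>2 * n * (K n m / m)) + (\<Sum>n=1..N. \<Sum>m=1..N. (b n)\<^sup>2 * n * (K n m / m))) / 2
      = (\<Sum>n=1..N. (b n)\<^sup>2 * n * (\<Sum>m=1..N. K n m / m))"
    by (simp only: half sum_distrib_left)
  also have "\<dots> \<le> (\<Sum>n=1..N. (b n)\<^sup>2 * n * (2 / \<delta>))"
    using schur_row_sum[OF assms(1,2)] by (intro sum_mono mult_left_mono) (auto simp: K_def)
  finally show ?thesis by (simp add: K_def sum_distrib_left mult_ac)
qed

lemma schur_test:
  assumes "0 < \<delta>"
  obtains C where "C > 0"
    "\<And>b N. (\<And>n. b n \<ge> 0) \<Longrightarrow>
      (\<Sum>n=1..N. \<Sum>m=1..N. b n * b m * (real (max n m) / real (min n m)) powr (- \<delta>))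
      \<le> C * (\<Sum>n=1..N. real n * (b n)\<^sup>2)"
proof
  \<comment> \<open>The row sum bound requires an exponent at most 1. Lowering the exponent only
    enlarges the kernel, as \<open>max / min\<close> is at least 1.\<close>
  define d where "d = min \<delta> 1"
  have d: "0 < d" "d \<le> 1" "d \<le> \<delta>" using assms by (auto simp: d_def)
  show "2 / d > 0" using d by simp
  fix b :: "nat \<Rightarrow> real" and N assume b: "\<And>n. b n \<ge> 0"
  have "(\<Sum>n=1..N. \<Sum>m=1..N. b n * b m * (real (max n m) / real (min n m)) powr (- \<delta>)) \<le>
     (\<Sum>n=1..N. \<Sum>m=1..N. b n * b m * (real (max n m) / real (min n m)) powr (- d))"
    using d b by (intro sum_mono mult_left_mono powr_mono) (auto simp: max_def min_def field_simps)
  also have "\<dots> \<le> 2 / d * (\<Sum>n=1..N. real n * (b n)\<^sup>2)"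
    by (rule schur_test_le) (use d b in auto)
  finally show "(\<Sum>n=1..N. \<Sum>m=1..N. b n * b m * (real (max n m) / real (min n m)) powr (- \<delta>))
      \<le> 2 / d * (\<Sum>n=1..N. real n * (b n)\<^sup>2)" .
qed

section \<open>The one-variable bound\<close>

abbreviation base_power :: "nat \<Rightarrow> complex poly \<Rightarrow> complex \<Rightarrow> complex"
  where "base_power n P z \<equiv> of_nat n powr (- poly P z)"

lemma holomorphic_base_power: "base_power n P holomorphic_on S"
proof (cases "n = 0")
  case False
  then have "base_power n P = (\<lambda>z. exp (- poly P z * of_real (ln n)))"
    by (auto simp: of_nat_powr)
  then show ?thesis by (auto intro!: holomorphic_intros)
qed (auto simp: powr_def)

lemma poly_Re_ge_on_disc:
  assumes "\<And>z. norm z = 1 \<Longrightarrow> m \<le> Re (poly P z)" "norm w \<le> 1"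
  shows "m \<le> Re (poly P w)"
proof -
  have "Re (- poly P w) \<le> - m"
  proof (rule maximum_real_frontier[where S = "cball 0 1" and f = "\<lambda>z. - poly P z" and \<xi> = w])
    show "(\<lambda>z. - poly P z) holomorphic_on interior (cball 0 1)"
      by (intro holomorphic_intros)
    show "continuous_on (closure (cball 0 1)) (\<lambda>z. - poly P z)"
      by (intro continuous_intros)
  qed (use assms in auto)
  then show ?thesis by simp
qed

text \<open>By the open mapping theorem some point of the disc has a value to the left of
  \<open>poly P w\<close>, and even that value has real part at least m.\<close>

lemma poly_Re_gt_in_disc:
  assumes "\<And>z. norm z < 1 \<Longrightarrow> m \<le> Re (poly P z)" "norm w < 1" "degree P > 0"
  shows "m < Re (poly P w)"
proof -
  have "open (poly P ` ball 0 1)"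
  proof (rule open_mapping_thm[where S = UNIV])
    show "\<not> poly P constant_on UNIV"
    proof
      assume "poly P constant_on UNIV"
      then obtain c where "poly (P - [:c:]) z = 0" for z
        by (auto simp: constant_on_def)
      then have "P = [:c:]"
        using poly_all_0_iff_0[of "P - [:c:]"] by simp
      with assms(3) show False by simp
    qed
  qed (auto intro!: holomorphic_intros)
  then obtain e where e: "e > 0" "ball (poly P w) e \<subseteq> poly P ` ball 0 1"
    using assms(2) by (force simp: open_contains_ball)
  have "poly P w - of_real (e / 2) \<in> ball (poly P w) e"
    using e by (simp add: dist_norm)
  with e obtain z where "norm z < 1" "poly P z = poly P w - of_real (e / 2)"
    by (metis (no_types, lifting) dist_0_norm imageE mem_ball subsetD)
  with assms(1)[of z] e(1) show ?thesis by simp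
qed

text \<open>
  With \<open>b n = a n * n powr - \<mu>\<close>, the square of the Dirichlet polynomial at \<open>poly P z\<close> is at most
  a sum of functions that are harmonic in \<open>z\<close>; the mean of that sum over the circle is its value
  at \<open>z = 0\<close>, where the Schur test applies.
\<close>
lemma one_variable_bound_interval:
  assumes "degree P > 0" and ge: "\<And>z. norm z = 1 \<Longrightarrow> \<mu> \<le> Re (poly P z)"
  obtains C where "C > 0"
    "\<And>a N K. (\<Sum>k<K. (norm (\<Sum>n=1..N. a n * taylor_coeff (base_power n P) k))\<^sup>2)
       \<le> C * (\<Sum>n=1..N. (norm (a n))\<^sup>2 * real n powr (1 - 2 * \<mu>))"
proof -
  define \<delta> where "\<delta> = Re (poly P 0) - \<mu>"
  have "\<delta> > 0" unfolding \<delta>_def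
    using poly_Re_gt_in_disc[of \<mu> P 0] poly_Re_ge_on_disc[OF ge] assms(1) by force
  then obtain C where C: "C > 0" "\<And>b N. (\<And>n. b n \<ge> 0) \<Longrightarrow>
      (\<Sum>n=1..N. \<Sum>m=1..N. b n * b m * (real (max n m) / real (min n m)) powr (- \<delta>))
      \<le> C * (\<Sum>n=1..N. real n * (b n)\<^sup>2)"
    by (rule schur_test) blast
  show thesis
  proof (rule that[OF C(1)])
    fix a :: "nat \<Rightarrow> complex" and N K :: nat
    define b where "b n = a n * of_nat n powr (- of_real \<mu>)" for n
    define F where "F z = (\<Sum>n=1..N. a n * base_power n P z)" for z
    define H where "H z = (\<Sum>n=1..N. \<Sum>m=1..N. b n * cnj (b m) * cross_power n m (poly P z - of_real \<mu>))" for z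
    have holF: "F holomorphic_on UNIV"
      unfolding F_def by (intro holomorphic_intros holomorphic_base_power)
    have cF: "continuous_on {0..1} (\<lambda>t. F (circle_point t))"
      by (rule continuous_on_compose2[OF holomorphic_on_imp_continuous_on[OF holF]])
         (auto intro: continuous_on_circle_point)
    \<comment> \<open>The entries with \<open>m > n\<close> are conjugates of entire functions; the
      mean value property passes through \<open>cnj\<close>.\<close>
    have H: "((\<lambda>t. H (circle_point t)) has_integral H 0) {0..1}"
    proof -
      have "((\<lambda>t. cross_power n m (poly P (circle_point t) - of_real \<mu>)) has_integral
          cross_power n m (poly P 0 - of_real \<mu>)) {0..1}" for n m
      proof (cases "m \<le> n")
        case True
        then show ?thesis unfolding cross_power_def
          by simp (rule mean_value_has_integral, intro holomorphic_intros)
      next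
        case False
        then show ?thesis unfolding cross_power_def
          by (simp only: if_False)
             (intro has_integral_linear[OF _ bounded_linear_cnj, unfolded o_def] mean_value_has_integral holomorphic_intros)
      qed
      then show ?thesis unfolding H_def
        by (intro has_integral_sum has_integral_mult_right) auto
    qed
    have le: "(norm (F (circle_point t)))\<^sup>2 \<le> Re (H (circle_point t))" for t
    proof -
      let ?z = "circle_point t"
      have "a n * base_power n P ?z = b n * of_nat n powr (- (poly P ?z - of_real \<mu>))" for n
        by (simp add: b_def powr_diff powr_minus divide_simps flip: powr_add)
      then have "F ?z = (\<Sum>n=1..N. b n * of_nat n powr (- (poly P ?z - of_real \<mu>)))"
        unfolding F_def by (intro sum.cong refl)
      then show ?thesis
        using norm_dirichlet_polynomial_le_cross[where s = "poly P ?z - of_real \<mu>" and N = N and b = b] ge[of ?z]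
        unfolding H_def by simp
    qed
    have "(\<Sum>k<K. (norm (\<Sum>n=1..N. a n * taylor_coeff (base_power n P) k))\<^sup>2)
        = (\<Sum>k<K. (norm (taylor_coeff F k))\<^sup>2)"
      unfolding F_def by (subst taylor_coeff_sum) (auto simp: holomorphic_base_power)
    also have "\<dots> \<le> integral {0..1} (\<lambda>t. (norm (F (circle_point t)))\<^sup>2)"
      by (rule bessel_inequality[OF holF])
    also have "\<dots> \<le> Re (H 0)"
    proof (rule has_integral_le)
      show "((\<lambda>t. (norm (F (circle_point t)))\<^sup>2) has_integral integral {0..1} (\<lambda>t. (norm (F (circle_point t)))\<^sup>2)) {0..1}"
        by (intro integrable_integral integrable_continuous_real continuous_intros cF)
      show "((\<lambda>t. Re (H (circle_point t))) has_integral Re (H 0)) {0..1}"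
        by (rule has_integral_Re[OF H])
    qed (rule le)
    also have "\<dots> \<le> norm (H 0)" by (rule complex_Re_le_cmod)
    also have "\<dots> \<le> (\<Sum>n=1..N. \<Sum>m=1..N. norm (b n) * norm (b m) * (real (max n m) / real (min n m)) powr (- \<delta>))"
      unfolding H_def 
      by (intro order_trans[OF norm_sum] sum_mono) (auto simp: norm_mult norm_cross_power \<delta>_def)
    also have "\<dots> \<le> C * (\<Sum>n=1..N. real n * (norm (b n))\<^sup>2)"
      by (rule C(2)) simp
    also have "(\<Sum>n=1..N. real n * (norm (b n))\<^sup>2) = (\<Sum>n=1..N. (norm (a n))\<^sup>2 * real n powr (1 - 2 * \<mu>))"
      by (intro sum.cong refl)
         (auto simp: b_def norm_mult norm_divide power_divide norm_of_nat_powr power_mult_distrib powr_diff powr_minus powr_power divide_simps)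
    finally show "(\<Sum>k<K. (norm (\<Sum>n=1..N. a n * taylor_coeff (base_power n P) k))\<^sup>2)
       \<le> C * (\<Sum>n=1..N. (norm (a n))\<^sup>2 * real n powr (1 - 2 * \<mu>))" .
  qed
qed

lemma taylor_coeff_zero [simp]: "taylor_coeff (\<lambda>z. 0) k = 0"
  using taylor_coeff_sum[of "{} :: nat set" "\<lambda>n z. 0" "\<lambda>_. 0" k] by simp

text \<open>Padding with zero coefficients extends the bound from intervals to arbitrary finite
  index sets, the form in which \<open>composition_expansion\<close> states it.\<close>

lemma one_variable_bound:
  assumes "degree P > 0" "\<And>z. norm z = 1 \<Longrightarrow> \<mu> \<le> Re (poly P z)"
  obtains C where "C > 0"
    "\<And>a F K. finite F \<Longrightarrow> (\<Sum>k<K. (norm (\<Sum>n\<in>F. a n * taylor_coeff (base_power n P) k))\<^sup>2)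
       \<le> C * (\<Sum>n\<in>F. (norm (a n))\<^sup>2 * real n powr (1 - 2 * \<mu>))"
proof (rule one_variable_bound_interval[OF assms])
  fix C :: real
  assume C: "C > 0" "\<And>a N K. (\<Sum>k<K. (norm (\<Sum>n=1..N. a n * taylor_coeff (base_power n P) k))\<^sup>2)
       \<le> C * (\<Sum>n=1..N. (norm (a n))\<^sup>2 * real n powr (1 - 2 * \<mu>))"
  show thesis
  proof (rule that[OF C(1)])
    fix a :: "nat \<Rightarrow> complex" and F :: "nat set" and K :: nat
    assume F: "finite F"
    define N where "N = Max (insert 0 F)"
    have N: "n \<le> N" if "n \<in> F" for n using that F by (simp add: N_def)
    define a' where "a' n = (if n \<in> F then a n else 0)" for n
    \<comment> \<open>An index 0 in F contributes nothing to either side, because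
      \<open>0 powr z = 0\<close>.\<close>
    have "(\<Sum>n\<in>F. a n * taylor_coeff (base_power n P) k) = (\<Sum>n=1..N. a' n * taylor_coeff (base_power n P) k)" for k
      using F N by (intro sum.mono_neutral_cong) (fastforce simp: a'_def not_less_eq_eq dest: N)+
    moreover have "(\<Sum>n\<in>F. (norm (a n))\<^sup>2 * real n powr (1 - 2 * \<mu>)) = (\<Sum>n=1..N. (norm (a' n))\<^sup>2 * real n powr (1 - 2 * \<mu>))"
      using F N by (intro sum.mono_neutral_cong) (fastforce simp: a'_def not_less_eq_eq dest: N)+
    ultimately show "(\<Sum>k<K. (norm (\<Sum>n\<in>F. a n * taylor_coeff (base_power n P) k))\<^sup>2)
       \<le> C * (\<Sum>n\<in>F. (norm (a n))\<^sup>2 * real n powr (1 - 2 * \<mu>))"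
      using C(2) by simp
  qed
qed

section \<open>Circle means of \<open>n powr (- 2 * Re P)\<close>\<close>

lemma inj_on_circle_point: "inj_on circle_point {0..<1}"
proof (rule inj_onI)
  fix s t :: real
  assume *: "s \<in> {0..<1}" "t \<in> {0..<1}" "circle_point s = circle_point t"
  then obtain k :: int where "2 * of_real pi * \<i> * of_real s = 2 * of_real pi * \<i> * of_real t + of_real (of_int (2 * k) * pi) * \<i>"
    unfolding circle_point_def exp_eq by auto
  then have "(2 * of_real pi * \<i>) * of_real s = (2 * of_real pi * \<i>) * (of_real t + of_int k)"
    by (simp add: algebra_simps)
  then have "complex_of_real s = of_real (t + of_int k)"
    by simp
  then have "s = t + of_int k"
    by (metis of_real_eq_iff)
  with * show "s = t" by auto
qed

text \<open>
  On the unit circle \<open>2 Re P = P + cnj P\<close> and \<open>cnj z = 1 / z\<close>, so after multiplication by a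
  power of \<open>z\<close> the condition becomes a polynomial equation.
\<close>
lemma finite_Re_poly_circle_eq:
  assumes "degree P > 0"
  shows "finite {t \<in> {0..1}. Re (poly P (circle_point t)) = \<mu>}"
proof -
  define D where "D = degree P"
  define R where "R = reflect_poly (map_poly cnj P)"
  \<comment> \<open>On the circle R equals \<open>z ^ D\<close> times the conjugate of P, so Q
    equals \<open>z ^ D * (2 * Re P - 2 * \<mu>)\<close>. Its degree is \<open>D + D\<close>, since
    R has degree at most D and D is positive; hence Q is not zero.\<close>
  define Q where "Q = monom 1 D * (P - [:of_real (2 * \<mu>):]) + R"
  have cnjP: "degree (map_poly cnj P) = D" 
    unfolding D_def by (rule degree_map_poly) simp
  have "degree R \<le> D" unfolding R_def using degree_reflect_poly_le cnjP by metis
  have dP: "degree (P - [:of_real (2 * \<mu>):]) = D"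
    using assms degree_add_eq_left[of "[:- of_real (2 * \<mu>):]" P]
    by (simp add: D_def diff_conv_add_uminus del: add_uminus_conv_diff)
  then have "degree (monom 1 D * (P - [:of_real (2 * \<mu>):])) = D + D"
    using assms by (subst degree_mult_eq) (auto simp: degree_monom_eq D_def)
  then have "degree Q = D + D"
    unfolding Q_def using \<open>degree R \<le> D\<close> assms by (subst degree_add_eq_left) (auto simp: D_def)
  then have "Q \<noteq> 0" using assms by (auto simp: D_def)
  then have fin: "finite {z. poly Q z = 0}" by (rule poly_roots_finite)
  have Q: "poly Q z = z ^ D * of_real (2 * Re (poly P z) - 2 * \<mu>)" if "norm z = 1" for z
  proof -
    have z: "z \<noteq> 0" "cnj (inverse z) = z"
      using that by (auto simp: divide_conv_cnj inverse_eq_divide)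
    have "poly (map_poly cnj P) w = cnj (poly P (cnj w))" for w
      by (simp add: poly_altdef degree_map_poly coeff_map_poly)
    then have "poly R z = z ^ D * cnj (poly P z)"
      unfolding R_def using z by (simp add: poly_reflect_poly_nz cnjP flip: complex_cnj_inverse)
    then show ?thesis
      unfolding Q_def by (simp add: poly_monom algebra_simps complex_eq_iff)
  qed
  have "finite {t \<in> {0..<1}. Re (poly P (circle_point t)) = \<mu>}"
  proof (rule finite_imageD)
    show "finite (circle_point ` {t \<in> {0..<1}. Re (poly P (circle_point t)) = \<mu>})"
      by (rule finite_subset[OF _ fin]) (auto simp: Q)
    show "inj_on circle_point {t \<in> {0..<1}. Re (poly P (circle_point t)) = \<mu>}"
      by (rule inj_on_subset[OF inj_on_circle_point]) auto
  qed
  then have "finite (insert 1 {t \<in> {0..<1}. Re (poly P (circle_point t)) = \<mu>})" by simp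
  then show ?thesis by (rule rev_finite_subset) auto
qed

definition circle_mean_sq :: "nat \<Rightarrow> complex poly \<Rightarrow> real"
  where "circle_mean_sq n P = integral {0..1} (\<lambda>t. (norm (base_power n P (circle_point t)))\<^sup>2)"

lemma norm_base_power_sq: "(norm (base_power n P z))\<^sup>2 = real n powr (- 2 * Re (poly P z))"
  by (cases "n = 0") (auto simp: norm_of_nat_powr powr_power mult.commute)

lemma continuous_base_power_circle: "continuous_on S (\<lambda>t. base_power n P (circle_point t))"
  by (rule continuous_on_compose2[OF holomorphic_on_imp_continuous_on[OF holomorphic_base_power]])
     (auto intro: continuous_on_circle_point)

lemma sum_taylor_coeff_base_power_le:
  "(\<Sum>k<K. (norm (taylor_coeff (base_power n P) k))\<^sup>2) \<le> circle_mean_sq n P"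
  unfolding circle_mean_sq_def by (rule bessel_inequality[OF holomorphic_base_power])

lemma circle_mean_sq_nonneg: "circle_mean_sq n P \<ge> 0"
  using sum_taylor_coeff_base_power_le[of n P 0] by simp

lemma integrable_base_power_sq:
  "(\<lambda>t. (norm (base_power n P (circle_point t)))\<^sup>2) integrable_on {0..1}"
  by (intro integrable_continuous_real continuous_intros continuous_base_power_circle)

lemma circle_mean_sq_le:
  assumes "\<And>z. norm z = 1 \<Longrightarrow> \<mu> \<le> Re (poly P z)"
  shows "circle_mean_sq n P \<le> real n powr (- 2 * \<mu>)"
proof (cases "n = 0")
  case False
  have "circle_mean_sq n P \<le> integral {0..1} (\<lambda>t :: real. real n powr (- 2 * \<mu>))"
    unfolding circle_mean_sq_def using assms False
    by (intro integral_le integrable_base_power_sq) (auto simp: norm_base_power_sq intro!: powr_mono)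
  then show ?thesis by simp
qed (simp add: circle_mean_sq_def)

text \<open>After normalisation the integrand is \<open>n powr (- 2 * (Re P - \<mu>))\<close>. It is
  at most 1 and tends to 0 except at the finitely many points where Re P equals \<mu>, so dominated
  convergence applies. This is the gain from an additional variable.\<close>

lemma circle_mean_sq_tendsto:
  assumes "degree P > 0" and ge: "\<And>z. norm z = 1 \<Longrightarrow> \<mu> \<le> Re (poly P z)"
  shows "(\<lambda>n. real n powr (2 * \<mu>) * circle_mean_sq n P) \<longlonglongrightarrow> 0"
proof -
  define f where "f n t = real n powr (2 * \<mu>) * (norm (base_power n P (circle_point t)))\<^sup>2" for n t
  define g :: "real \<Rightarrow> real" where "g t = of_bool (Re (poly P (circle_point t)) = \<mu>)" for t
  have f: "f n t = real n powr (- (2 * (Re (poly P (circle_point t)) - \<mu>)))" for n t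
    by (cases "n = 0") (simp_all add: f_def norm_base_power_sq flip: powr_add)
  have "(\<lambda>n. integral {0..1} (f n)) \<longlonglongrightarrow> integral {0..1} g"
  proof (rule dominated_convergence)
    show "f n integrable_on {0..1}" for n
      unfolding f_def by (intro integrable_on_mult_right integrable_base_power_sq)
    show "norm (f n t) \<le> 1" for n t
    proof (cases "n = 0")
      case False
      then have "f n t \<le> real n powr 0"
        unfolding f using ge[of "circle_point t"] by (intro powr_mono) auto
      then show ?thesis using False by (simp add: f)
    qed (simp add: f)
    show "(\<lambda>n. f n t) \<longlonglongrightarrow> g t" for t
    proof (cases "Re (poly P (circle_point t)) = \<mu>")
      case True
      then have "f n t = 1" if "n \<ge> 1" for n using that by (simp add: f)
      then have "\<forall>\<^sub>F n in sequentially. f n t = 1"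
        by (auto simp: eventually_sequentially)
      then show ?thesis using True by (auto simp: g_def intro: tendsto_eventually)
    next
      case False
      then have "Re (poly P (circle_point t)) > \<mu>" using ge[of "circle_point t"] by simp
      then show ?thesis unfolding f g_def using False
        by (auto intro!: tendsto_neg_powr filterlim_real_sequentially)
    qed
  qed auto
  also have "integral {0..1} g = 0"
  proof (rule integral_unique, rule has_integral_spike_finite)
    show "finite {t \<in> {0..1}. Re (poly P (circle_point t)) = \<mu>}"
      by (rule finite_Re_poly_circle_eq[OF assms(1)])
    show "((\<lambda>t :: real. 0 :: real) has_integral 0) {0..1}" by simp
  qed (auto simp: g_def)
  finally show ?thesis unfolding f_def circle_mean_sq_def by simp
qed

section \<open>Several variables\<close>

lemma rat_independent_integers_subset:
  "rat_independent_integers B \<Longrightarrow> A \<subseteq> B \<Longrightarrow> rat_independent_integers A"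
  using rat_real.independent_mono[OF _ image_mono[of A B "\<lambda>n. ln (real n)"]]
  by (auto simp: rat_independent_integers_def)

text \<open>Independence is stated for a set of reals with rational coefficients. Injectivity of q
  and of the logarithm turns it into a statement about integer coefficients indexed by J.\<close>

lemma rat_independent_integersD:
  assumes "inj_on q J" "rat_independent_integers (q ` J)" "finite J"
    and "(\<Sum>j\<in>J. of_int (c j) * ln (real (q j))) = 0" "j \<in> J"
  shows "c j = 0"
proof -
  have q2: "q j \<ge> 2" if "j \<in> J" for j
    using assms(2) that by (auto simp: rat_independent_integers_def)
  have inj: "inj_on (\<lambda>j. ln (real (q j))) J"
  proof (rule inj_onI)
    fix i j assume *: "i \<in> J" "j \<in> J" "ln (real (q i)) = ln (real (q j))"
    then have "q i = q j" using q2[of i] q2[of j] by simp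
    with * assms(1) show "i = j" by (auto dest: inj_onD)
  qed
  define u where "u x = (of_int (c (the_inv_into J (\<lambda>j. ln (real (q j))) x)) :: rat)" for x
  have u: "u (ln (real (q j))) = of_int (c j)" if "j \<in> J" for j
    unfolding u_def by (subst the_inv_into_f_f[OF inj that]) simp
  have "u (ln (real (q j))) = 0"
  proof (rule rat_real.independentD)
    show "rat_real.independent ((\<lambda>n. ln (real n)) ` q ` J)"
      using assms(2) by (simp add: rat_independent_integers_def)
    show "(\<Sum>v\<in>(\<lambda>n. ln (real n)) ` q ` J. of_rat (u v) * v) = 0"
      using inj assms(4) by (simp add: image_image sum.reindex u)
  qed (use assms in auto)
  then show ?thesis using u[OF assms(5)] by simp
qed

text \<open>These are the frequencies that occur in the Dirichlet series of
  \<open>n powr (- \<phi> s)\<close> for a symbol in the first J variables.\<close>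

definition generated_monoid :: "(nat \<Rightarrow> nat) \<Rightarrow> nat \<Rightarrow> nat set"
  where "generated_monoid q J = range (\<lambda>k. \<Prod>j=1..J. q j ^ k j)"

text \<open>The \<open>q j\<close> need not be prime, so unique factorisation is replaced by
  Q-independence: taking logarithms gives a vanishing integer combination of the
  \<open>ln (q j)\<close>, and all differences of exponents are zero.\<close>

lemma generated_monoid_unique:
  assumes "inj_on q {1..Suc J}" "rat_independent_integers (q ` {1..Suc J})"
    and "l \<in> generated_monoid q J" "l' \<in> generated_monoid q J"
    and eq: "l * q (Suc J) ^ k = l' * q (Suc J) ^ k'"
  shows "l = l' \<and> k = k'"
proof -
  obtain a a' where a: "l = (\<Prod>j=1..J. q j ^ a j)" "l' = (\<Prod>j=1..J. q j ^ a' j)"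
    using assms(3,4) by (auto simp: generated_monoid_def)
  define b b' where "b = a(Suc J := k)" and "b' = a'(Suc J := k')"
  have q2: "q j > 0" if "j \<in> {1..Suc J}" for j
    using assms(2) that by (force simp: rat_independent_integers_def)
  have ln: "ln (real (\<Prod>j=1..Suc J. q j ^ c j)) = (\<Sum>j=1..Suc J. of_int (int (c j)) * ln (real (q j)))" for c
    using q2 by (subst of_nat_prod, subst ln_prod) (auto simp: ln_realpow)
  have "(\<Prod>j=1..Suc J. q j ^ b j) = l * q (Suc J) ^ k" "(\<Prod>j=1..Suc J. q j ^ b' j) = l' * q (Suc J) ^ k'"
    by (auto simp: a b_def b'_def intro!: prod.cong)
  with eq have "(\<Prod>j=1..Suc J. q j ^ b j) = (\<Prod>j=1..Suc J. q j ^ b' j)" by presburger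
  then have "(\<Sum>j=1..Suc J. of_int (int (b j)) * ln (real (q j))) = (\<Sum>j=1..Suc J. of_int (int (b' j)) * ln (real (q j)))"
    by (metis ln)
  then have "(\<Sum>j=1..Suc J. of_int (int (b j) - int (b' j)) * ln (real (q j))) = 0"
    by (simp only: of_int_diff left_diff_distrib sum_subtractf)
  then have bb: "b j = b' j" if "j \<in> {1..Suc J}" for j
    using rat_independent_integersD[OF assms(1,2) _ _ that, of "\<lambda>j. int (b j) - int (b' j)"] by simp
  have "k = k'" using bb[of "Suc J"] by (simp add: b_def b'_def)
  moreover have "a j = a' j" if "j \<in> {1..J}" for j
    using bb[of j] that by (auto simp: b_def b'_def)
  ultimately show ?thesis unfolding a by (metis (mono_tags, lifting) prod.cong)
qed

lemma generated_monoid_Suc: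
  "generated_monoid q (Suc J) = (\<lambda>(l, k). l * q (Suc J) ^ k) ` (generated_monoid q J \<times> UNIV)"
proof safe
  fix x assume "x \<in> generated_monoid q (Suc J)"
  then obtain a where "x = (\<Prod>j=1..J. q j ^ a j) * q (Suc J) ^ a (Suc J)"
    by (auto simp: generated_monoid_def)
  then show "x \<in> (\<lambda>(l, k). l * q (Suc J) ^ k) ` (generated_monoid q J \<times> UNIV)"
    by (auto simp: generated_monoid_def image_iff)
next
  fix l k assume "l \<in> generated_monoid q J"
  then obtain a where a: "l = (\<Prod>j=1..J. q j ^ a j)"
    by (auto simp: generated_monoid_def)
  have "l * q (Suc J) ^ k = (\<Prod>j=1..Suc J. q j ^ (a(Suc J := k)) j)"
    by (auto simp: a intro!: prod.cong)
  then show "l * q (Suc J) ^ k \<in> generated_monoid q (Suc J)"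
    unfolding generated_monoid_def by blast
qed

lemma of_nat_mult_powr:
  "of_nat (l * m) powr (z :: complex) = of_nat l powr z * of_nat m powr z"
proof (cases "l = 0 \<or> m = 0")
  case False
  then have "ln (real (l * m)) = ln (real l) + ln (real m)"
    by (simp add: ln_mult)
  with False show ?thesis
    by (simp add: of_nat_powr distrib_left exp_add del: of_nat_mult)
qed auto

lemma of_nat_power_powr:
  "of_nat (q ^ k) powr (z :: complex) = (of_nat q powr z) ^ k" if "q > 0"
proof (induction k)
  case (Suc k)
  then show ?case by (simp only: power_Suc of_nat_mult_powr)
qed simp

text \<open>Unconditional summability in the complex numbers is absolute, so the product family is
  absolutely summable and may be summed in either variable first.\<close>

lemma has_sum_product_complex:
  fixes f g :: "_ \<Rightarrow> complex"
  assumes f: "(f has_sum a) A" and g: "(g has_sum b) B"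
  shows "((\<lambda>(x, y). f x * g y) has_sum (a * b)) (A \<times> B)"
proof (rule has_sum_SigmaI)
  show "((\<lambda>y. case (x, y) of (x, y) \<Rightarrow> f x * g y) has_sum (f x * b)) B" for x
    using has_sum_cmult_right[OF g] by simp
  show "((\<lambda>x. f x * b) has_sum (a * b)) A"
    by (rule has_sum_cmult_left[OF f])
  have "(\<lambda>x. norm (f x)) summable_on A" "(\<lambda>y. norm (g y)) summable_on B"
    using has_sum_imp_summable[OF f] has_sum_imp_summable[OF g]
    by (simp_all only: summable_on_iff_abs_summable_on_complex)
  then have "(\<lambda>p. norm (case p of (x, y) \<Rightarrow> f x * g y)) summable_on (A \<times> B)"
    by (subst Infinite_Sum.abs_summable_on_Sigma_iff)
       (auto simp: norm_mult infsum_cmult_right' abs_mult intro!: summable_on_cmult_right summable_on_cmult_left)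
  then show "(\<lambda>(x, y). f x * g y) summable_on (A \<times> B)"
    by (rule Infinite_Sum.abs_summable_summable)
qed

text \<open>
  The second clause states that the synthesis map \<open>a \<mapsto> \<Sum>n. a n * B n\<close> is bounded from a
  weighted \<open>\<ell>\<^sup>2\<close> space to \<open>\<ell>\<^sup>2\<close>.
\<close>
definition composition_expansion ::
    "nat set \<Rightarrow> (nat \<Rightarrow> nat \<Rightarrow> complex) \<Rightarrow> (complex \<Rightarrow> complex) \<Rightarrow> (nat \<Rightarrow> real) \<Rightarrow> bool"
  where "composition_expansion S B \<phi> W \<longleftrightarrow>
    (\<forall>n s. Re s > 0 \<longrightarrow> ((\<lambda>l. B n l * of_nat l powr (- s)) has_sum of_nat n powr (- \<phi> s)) S) \<and>
    (\<forall>F L a. finite F \<longrightarrow> finite L \<longrightarrow> L \<subseteq> S \<longrightarrow>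
      (\<Sum>l\<in>L. (norm (\<Sum>n\<in>F. a n * B n l))\<^sup>2) \<le> (\<Sum>n\<in>F. (norm (a n))\<^sup>2 * W n))"

lemma taylor_coeff_base_power_has_sum:
  assumes "norm z \<le> 1"
  shows "((\<lambda>k. taylor_coeff (base_power n P) k * z ^ k) has_sum base_power n P z) UNIV"
proof (rule norm_summable_imp_has_sum)
  show "summable (\<lambda>k. norm (taylor_coeff (base_power n P) k * z ^ k))"
    using assms
    by (intro summable_comparison_test'[OF summable_norm_taylor_coeff[OF holomorphic_base_power]])
       (auto simp: norm_mult norm_power intro!: mult_left_le power_le_one)
qed (rule taylor_coeff_sums[OF holomorphic_base_power])

lemma norm_nat_powr_le_1:
  assumes "Re s \<ge> 0"
  shows "norm (of_nat q powr (- s)) \<le> 1"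
  using assms powr_mono[of "- Re s" 0 "real q"] by (cases "q = 0") (auto simp: norm_of_nat_powr)

lemma finite_subset_range_image:
  fixes h :: "nat \<Rightarrow> 'a"
  assumes "finite L" "L \<subseteq> range h"
  obtains K where "L \<subseteq> h ` {..<K}"
proof -
  obtain X where X: "finite X" "L = h ` X"
    using finite_subset_image[OF assms] by blast
  obtain K where "X \<subseteq> {..<K}" using X(1) finite_nat_iff_bounded by blast
  with X that show thesis by blast
qed

text \<open>The substitution \<open>z = q powr (- s)\<close> maps \<open>Re s > 0\<close> into the
  unit disc and turns the Taylor series of \<open>base_power n P\<close> into a Dirichlet series
  supported on the powers of q.\<close>

lemma composition_expansion_one_variable:
  assumes "q \<ge> 2" "degree P > 0" "\<And>z. norm z = 1 \<Longrightarrow> \<mu> \<le> Re (poly P z)"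
  obtains B C where "C > 0"
    "composition_expansion (range (\<lambda>k. q ^ k)) B (\<lambda>s. poly P (of_nat q powr (- s)))
      (\<lambda>n. C * real n powr (1 - 2 * \<mu>))"
proof -
  obtain C where C: "C > 0" "\<And>a F K. finite F \<Longrightarrow>
      (\<Sum>k<K. (norm (\<Sum>n\<in>F. a n * taylor_coeff (base_power n P) k))\<^sup>2)
       \<le> C * (\<Sum>n\<in>F. (norm (a n))\<^sup>2 * real n powr (1 - 2 * \<mu>))"
    by (rule one_variable_bound[OF assms(2,3)]) blast+
  define h where "h k = q ^ k" for k
  have inj: "inj h" using assms(1) by (auto simp: h_def inj_def)
  define B where "B n l = taylor_coeff (base_power n P) (inv h l)" for n l
  have B: "B n (h k) = taylor_coeff (base_power n P) k" for n k
    by (simp add: B_def inj)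
  have "composition_expansion (range h) B (\<lambda>s. poly P (of_nat q powr (- s))) (\<lambda>n. C * real n powr (1 - 2 * \<mu>))"
    unfolding composition_expansion_def
  proof (intro conjI allI impI)
    fix n s assume "Re s > 0"
    then have "((\<lambda>k. taylor_coeff (base_power n P) k * (of_nat q powr (- s)) ^ k) has_sum base_power n P (of_nat q powr (- s))) UNIV"
      by (intro taylor_coeff_base_power_has_sum norm_nat_powr_le_1) auto
    moreover have "of_nat (h k) powr (- s) = (of_nat q powr (- s)) ^ k" for k
      using assms(1) unfolding h_def by (intro of_nat_power_powr) auto
    ultimately show "((\<lambda>l. B n l * of_nat l powr (- s)) has_sum base_power n P (of_nat q powr (- s))) (range h)"
      by (subst has_sum_reindex[OF inj]) (simp add: o_def B)
  next
    fix F L :: "nat set" and a :: "nat \<Rightarrow> complex"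
    assume F: "finite F" and L: "finite L" "L \<subseteq> range h"
    obtain K where K: "L \<subseteq> h ` {..<K}" by (rule finite_subset_range_image[OF L])
    have "(\<Sum>l\<in>L. (norm (\<Sum>n\<in>F. a n * B n l))\<^sup>2) \<le> (\<Sum>l\<in>h ` {..<K}. (norm (\<Sum>n\<in>F. a n * B n l))\<^sup>2)"
      using K by (intro sum_mono2) auto
    also have "\<dots> = (\<Sum>k<K. (norm (\<Sum>n\<in>F. a n * taylor_coeff (base_power n P) k))\<^sup>2)"
      using inj by (subst sum.reindex) (auto simp: B intro: inj_on_subset)
    also have "\<dots> \<le> C * (\<Sum>n\<in>F. (norm (a n))\<^sup>2 * real n powr (1 - 2 * \<mu>))"
      by (rule C(2)[OF F])
    finally show "(\<Sum>l\<in>L. (norm (\<Sum>n\<in>F. a n * B n l))\<^sup>2) \<le> (\<Sum>n\<in>F. (norm (a n))\<^sup>2 * (C * real n powr (1 - 2 * \<mu>)))"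
      by (simp add: sum_distrib_left mult_ac)
  qed
  then show thesis using that[OF C(1)] by (simp add: h_def)
qed

text \<open>
  Adjoining a variable: for a fixed power \<open>q ^ k\<close> the known bound is applied to the coefficients
  \<open>a n\<close> times the \<open>k\<close>-th Taylor coefficient, and then summed over \<open>k\<close>.
\<close>
lemma composition_expansion_step:
  assumes BS: "composition_expansion S B \<phi> W" and "q \<ge> 2" and W: "\<And>n. W n \<ge> 0"
    and inj: "inj_on (\<lambda>(l, k). l * q ^ k) (S \<times> UNIV)"
  obtains B' where "composition_expansion ((\<lambda>(l, k). l * q ^ k) ` (S \<times> UNIV)) B'
      (\<lambda>s. \<phi> s + poly P (of_nat q powr (- s))) (\<lambda>n. W n * circle_mean_sq n P)"
proof -
  define h where "h = (\<lambda>(l :: nat, k :: nat). l * q ^ k)"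
  note inj = inj[folded h_def]
  define A where "A n k = taylor_coeff (base_power n P) k" for n k
  define B' where "B' n x = (case the_inv_into (S \<times> UNIV) h x of (l, k) \<Rightarrow> B n l * A n k)" for n x
  have B': "B' n (h (l, k)) = B n l * A n k" if "l \<in> S" for n l k
    using that by (simp add: B'_def the_inv_into_f_f[OF inj])
  have "composition_expansion (h ` (S \<times> UNIV)) B' (\<lambda>s. \<phi> s + poly P (of_nat q powr (- s))) (\<lambda>n. W n * circle_mean_sq n P)"
    unfolding composition_expansion_def
  proof (intro conjI allI impI)
    fix n s assume s: "Re s > 0"
    have 1: "((\<lambda>k. A n k * (of_nat q powr (- s)) ^ k) has_sum base_power n P (of_nat q powr (- s))) UNIV"
      using s unfolding A_def by (intro taylor_coeff_base_power_has_sum norm_nat_powr_le_1) auto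
    have 2: "((\<lambda>l. B n l * of_nat l powr (- s)) has_sum of_nat n powr (- \<phi> s)) S"
      using BS s by (auto simp: composition_expansion_def)
    have "of_nat n powr (- (\<phi> s + poly P (of_nat q powr - s))) = of_nat n powr (- \<phi> s) * base_power n P (of_nat q powr - s)"
      by (simp flip: powr_add)
    moreover have "((\<lambda>x. B' n x * of_nat x powr (- s)) has_sum of_nat n powr (- \<phi> s) * base_power n P (of_nat q powr (- s))) (h ` (S \<times> UNIV))"
      unfolding has_sum_reindex[OF inj]
    proof (rule has_sum_cong[THEN iffD1, OF _ has_sum_product_complex[OF 2 1]])
      fix x assume "x \<in> S \<times> (UNIV :: nat set)"
      then obtain l k where x: "x = (l, k)" "l \<in> S" by auto
      have "of_nat (h (l, k)) powr - s = of_nat l powr (- s) * (of_nat q powr (- s)) ^ k"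
        using \<open>q \<ge> 2\<close> unfolding h_def by (simp only: prod.case of_nat_mult_powr of_nat_power_powr)
      then show "(case x of (l, k) \<Rightarrow> B n l * of_nat l powr - s * (A n k * (of_nat q powr - s) ^ k)) =
          ((\<lambda>x. B' n x * of_nat x powr - s) \<circ> h) x"
        using x by (simp add: B')
    qed
    ultimately show "((\<lambda>x. B' n x * of_nat x powr (- s)) has_sum
        of_nat n powr (- (\<phi> s + poly P (of_nat q powr - s)))) (h ` (S \<times> UNIV))" by simp
  next
    fix F L :: "nat set" and a :: "nat \<Rightarrow> complex"
    assume F: "finite F" and L: "finite L" "L \<subseteq> h ` (S \<times> UNIV)"
    obtain X where X: "X \<subseteq> S \<times> UNIV" "finite X" "L = h ` X"
      using finite_subset_image[OF L] by blast
    obtain K where K: "snd ` X \<subseteq> {..<K}" using X(2) finite_nat_iff_bounded by blast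
    \<comment> \<open>The finite set of frequencies is enlarged to a rectangle, so that the sum over
      l can be bounded for each k separately.\<close>
    define Y where "Y = fst ` X"
    have Y: "finite Y" "Y \<subseteq> S" using X by (auto simp: Y_def)
    have XY: "X \<subseteq> Y \<times> {..<K}" using K by (force simp: Y_def)
    have "(\<Sum>x\<in>L. (norm (\<Sum>n\<in>F. a n * B' n x))\<^sup>2) = (\<Sum>(l, k)\<in>X. (norm (\<Sum>n\<in>F. (a n * A n k) * B n l))\<^sup>2)"
      unfolding X(3) using X(1) 
      by (subst sum.reindex[OF inj_on_subset[OF inj X(1)]]) (auto simp: B' mult_ac intro!: sum.cong)
    also have "\<dots> \<le> (\<Sum>(l, k)\<in>Y \<times> {..<K}. (norm (\<Sum>n\<in>F. (a n * A n k) * B n l))\<^sup>2)"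
      using Y XY by (intro sum_mono2) auto
    also have "\<dots> = (\<Sum>k<K. \<Sum>l\<in>Y. (norm (\<Sum>n\<in>F. (a n * A n k) * B n l))\<^sup>2)"
      by (subst sum.swap) (simp add: sum.cartesian_product)
    also have "\<dots> \<le> (\<Sum>k<K. \<Sum>n\<in>F. (norm (a n * A n k))\<^sup>2 * W n)"
      using BS F Y by (intro sum_mono) (auto simp: composition_expansion_def)
    also have "\<dots> = (\<Sum>n\<in>F. (norm (a n))\<^sup>2 * W n * (\<Sum>k<K. (norm (A n k))\<^sup>2))"
      by (subst sum.swap) (simp add: norm_mult power_mult_distrib sum_distrib_left mult_ac)
    also have "\<dots> \<le> (\<Sum>n\<in>F. (norm (a n))\<^sup>2 * W n * circle_mean_sq n P)"
      unfolding A_def using W by (intro sum_mono mult_left_mono sum_taylor_coeff_base_power_le) auto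
    finally show "(\<Sum>x\<in>L. (norm (\<Sum>n\<in>F. a n * B' n x))\<^sup>2) \<le> (\<Sum>n\<in>F. (norm (a n))\<^sup>2 * (W n * circle_mean_sq n P))"
      by (simp add: mult_ac)
  qed
  then show thesis using that by (simp add: h_def)
qed

text \<open>Induction on the number of variables, starting from one: the factor n of the Schur test
  appears only in the base case, and every later variable multiplies the weight by its circle
  mean.\<close>

lemma composition_expansion_exists:
  assumes "d \<ge> 1" "inj_on q {1..d}" "rat_independent_integers (q ` {1..d})"
    and "degree (P 1) > 0" "\<And>z. norm z = 1 \<Longrightarrow> \<mu> \<le> Re (poly (P 1) z)"
  obtains B C where "C > 0"
    "composition_expansion (generated_monoid q d) B (\<lambda>s. \<Sum>j=1..d. poly (P j) (of_nat (q j) powr (- s)))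
      (\<lambda>n. C * real n powr (1 - 2 * \<mu>) * (\<Prod>j=2..d. circle_mean_sq n (P j)))"
proof -
  have q2: "q j \<ge> 2" if "j \<in> {1..d}" for j
    using assms(3) that by (force simp: rat_independent_integers_def)
  obtain B0 C where C: "C > 0" "composition_expansion (range (\<lambda>k. q 1 ^ k)) B0 (\<lambda>s. poly (P 1) (of_nat (q 1) powr (- s)))
      (\<lambda>n. C * real n powr (1 - 2 * \<mu>))"
    by (rule composition_expansion_one_variable[where q = "q 1" and P = "P 1" and \<mu> = \<mu>]) (use q2[of 1] assms(1,4,5) in simp_all)
  have gm1: "generated_monoid q (Suc 0) = range (\<lambda>k. q (Suc 0) ^ k)"
    by (fastforce simp: generated_monoid_def)
  have "\<exists>B. composition_expansion (generated_monoid q J) B (\<lambda>s. \<Sum>j=1..J. poly (P j) (of_nat (q j) powr (- s)))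
      (\<lambda>n. C * real n powr (1 - 2 * \<mu>) * (\<Prod>j=2..J. circle_mean_sq n (P j)))" if "1 \<le> J" "J \<le> d" for J
    using that
  proof (induction J rule: dec_induct)
    case base
    show ?case using C by (auto simp: gm1)
  next
    case (step J)
    then obtain B where B: "composition_expansion (generated_monoid q J) B (\<lambda>s. \<Sum>j=1..J. poly (P j) (of_nat (q j) powr (- s)))
      (\<lambda>n. C * real n powr (1 - 2 * \<mu>) * (\<Prod>j=2..J. circle_mean_sq n (P j)))" by auto
    have sub: "{1..Suc J} \<subseteq> {1..d}" using step by auto
    have inj: "inj_on (\<lambda>(l, k). l * q (Suc J) ^ k) (generated_monoid q J \<times> UNIV)"
    proof (rule inj_onI, clarify)
      fix l k l' k'
      assume "l \<in> generated_monoid q J" "l' \<in> generated_monoid q J"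
        "l * q (Suc J) ^ k = l' * q (Suc J) ^ k'"
      then show "l = l' \<and> k = k'"
        by (rule generated_monoid_unique[OF inj_on_subset[OF assms(2) sub]
              rat_independent_integers_subset[OF assms(3) image_mono[OF sub]]])
    qed
    obtain B' where "composition_expansion ((\<lambda>(l, k). l * q (Suc J) ^ k) ` (generated_monoid q J \<times> UNIV)) B'
      (\<lambda>s. (\<Sum>j=1..J. poly (P j) (of_nat (q j) powr (- s))) + poly (P (Suc J)) (of_nat (q (Suc J)) powr (- s)))
      (\<lambda>n. C * real n powr (1 - 2 * \<mu>) * (\<Prod>j=2..J. circle_mean_sq n (P j)) * circle_mean_sq n (P (Suc J)))"
      using step q2 C(1)
      by (rule_tac composition_expansion_step[OF B _ _ inj, of "P (Suc J)"])
         (auto intro!: mult_nonneg_nonneg prod_nonneg circle_mean_sq_nonneg)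
    then show ?case using step by (auto simp: generated_monoid_Suc mult_ac)
  qed
  then show thesis using that C(1) assms(1) by blast
qed

section \<open>Compactness\<close>

lemma Cauchy_Schwarz_suminf:
  fixes f g :: "nat \<Rightarrow> real"
  assumes "summable (\<lambda>n. (f n)\<^sup>2)" "summable (\<lambda>n. (g n)\<^sup>2)" "\<And>n. f n \<ge> 0" "\<And>n. g n \<ge> 0"
  shows "summable (\<lambda>n. f n * g n)"
    and "(\<Sum>n. f n * g n)\<^sup>2 \<le> (\<Sum>n. (f n)\<^sup>2) * (\<Sum>n. (g n)\<^sup>2)"
proof -
  define M where "M = (\<Sum>n. (f n)\<^sup>2) * (\<Sum>n. (g n)\<^sup>2)"
  have M: "(\<Sum>n\<in>A. f n * g n) \<le> sqrt M" if "finite A" for A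
  proof (rule real_le_rsqrt)
    have "(\<Sum>n\<in>A. f n * g n)\<^sup>2 \<le> (\<Sum>n\<in>A. (f n)\<^sup>2) * (\<Sum>n\<in>A. (g n)\<^sup>2)"
      by (rule Cauchy_Schwarz_ineq_sum)
    also have "\<dots> \<le> M" unfolding M_def using assms that
      by (intro mult_mono sum_le_suminf suminf_nonneg sum_nonneg) auto
    finally show "(\<Sum>n\<in>A. f n * g n)\<^sup>2 \<le> M" .
  qed
  show s: "summable (\<lambda>n. f n * g n)"
    using assms by (intro bounded_imp_summable[where B = "sqrt M"] M) auto
  have "(\<Sum>n. f n * g n) \<le> sqrt M"
    by (intro suminf_le_const s M) auto
  moreover have "(\<Sum>n. f n * g n) \<ge> 0" using s assms by (intro suminf_nonneg) auto
  ultimately have "(\<Sum>n. f n * g n)\<^sup>2 \<le> (sqrt M)\<^sup>2" by (intro power_mono)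
  also have "\<dots> = M" unfolding M_def using assms
    by (intro real_sqrt_pow2 mult_nonneg_nonneg suminf_nonneg) auto
  finally show "(\<Sum>n. f n * g n)\<^sup>2 \<le> (\<Sum>n. (f n)\<^sup>2) * (\<Sum>n. (g n)\<^sup>2)" unfolding M_def .
qed

section \<open>Point evaluations on \<open>dirichlet_h2\<close>\<close>

lemma summable_norm_nat_powr_sq:
  assumes "Re s > 1/2"
  shows "summable (\<lambda>n. (norm (of_nat n powr (- s)))\<^sup>2)"
proof -
  have "summable (\<lambda>n. real n powr (- 2 * Re s))" using assms by (simp add: summable_real_powr_iff)
  moreover have "(norm (of_nat n powr (- s)))\<^sup>2 = real n powr (- 2 * Re s)" for n
    by (cases "n = 0") (auto simp: norm_of_nat_powr powr_power mult.commute)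
  ultimately show ?thesis by simp
qed

lemma h2_eval_summable:
  assumes "Re s > 1/2"
  shows "summable (\<lambda>n. norm (h2_coeff f n * of_nat n powr (- s)))"
  unfolding norm_mult
  by (rule Cauchy_Schwarz_suminf(1)[OF h2_summable summable_norm_nat_powr_sq[OF assms]]) auto

lemma h2_eval_sums:
  assumes "Re s > 1/2"
  shows "(\<lambda>n. h2_coeff f n * of_nat n powr (- s)) sums h2_eval f s"
  unfolding h2_eval_def dirichlet_series_def
  by (intro summable_sums summable_norm_cancel[OF h2_eval_summable[OF assms]])

lemma h2_eval_bound:
  assumes "Re s > 1/2"
  obtains K where "K > 0" "\<And>f. norm (h2_eval f s) \<le> K * norm f"
proof -
  define K2 where "K2 = (\<Sum>n. (norm (of_nat n powr (- s)))\<^sup>2)"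
  have K2: "K2 \<ge> 0" unfolding K2_def
    by (intro suminf_nonneg summable_norm_nat_powr_sq assms) auto
  have "norm (h2_eval f s) \<le> (sqrt K2 + 1) * norm f" for f
  proof -
    have "norm (h2_eval f s) \<le> (\<Sum>n. norm (h2_coeff f n) * norm (of_nat n powr (- s)))"
      unfolding h2_eval_def dirichlet_series_def norm_mult[symmetric]
      by (rule summable_norm[OF h2_eval_summable[OF assms]])
    moreover have "(\<Sum>n. norm (h2_coeff f n) * norm (of_nat n powr (- s)))\<^sup>2 \<le> (norm f)\<^sup>2 * K2"
      unfolding norm_dirichlet_h2_sq K2_def
      by (rule Cauchy_Schwarz_suminf(2)[OF h2_summable summable_norm_nat_powr_sq[OF assms]]) auto
    then have "(\<Sum>n. norm (h2_coeff f n) * norm (of_nat n powr (- s))) \<le> sqrt ((norm f)\<^sup>2 * K2)"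
      by (rule real_le_rsqrt)
    then have "(\<Sum>n. norm (h2_coeff f n) * norm (of_nat n powr (- s))) \<le> norm f * sqrt K2"
      by (simp add: real_sqrt_mult)
    ultimately have "norm (h2_eval f s) \<le> norm f * sqrt K2" by linarith
    also have "\<dots> \<le> (sqrt K2 + 1) * norm f" by (simp add: algebra_simps)
    finally show ?thesis .
  qed
  with K2 that[of "sqrt K2 + 1"] show thesis by (simp add: add_nonneg_pos)
qed

lemma h2_eval_diff:
  assumes "Re s > 1/2"
  shows "h2_eval (f - g) s = h2_eval f s - h2_eval g s"
  using sums_unique2[OF h2_eval_sums[OF assms, of "f - g"]]
    sums_diff[OF h2_eval_sums[OF assms, of f] h2_eval_sums[OF assms, of g]]
  by (simp add: minus_dirichlet_h2.rep_eq left_diff_distrib)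

lemma h2_eval_tendsto:
  assumes "Re s > 1/2" "X \<longlonglongrightarrow> f"
  shows "(\<lambda>k. h2_eval (X k) s) \<longlonglongrightarrow> h2_eval f s"
proof -
  obtain K where K: "K > 0" "\<And>f. norm (h2_eval f s) \<le> K * norm f"
    by (rule h2_eval_bound[OF assms(1)]) blast
  have "(\<lambda>k. K * norm (X k - f)) \<longlonglongrightarrow> 0"
    by (intro tendsto_mult_right_zero tendsto_norm_zero LIM_zero assms(2))
  then have "(\<lambda>k. h2_eval (X k) s - h2_eval f s) \<longlonglongrightarrow> 0"
    by (rule Lim_null_comparison[where g = "\<lambda>k. K * norm (X k - f)", rotated])
       (simp only: h2_eval_diff[OF assms(1), symmetric] K(2) eventually_True)
  then show ?thesis by (simp add: LIM_zero_iff)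
qed

lemma norm_h2_sq_le:
  assumes "\<And>N. (\<Sum>n<N. (norm (h2_coeff f n))\<^sup>2) \<le> x"
  shows "(norm f)\<^sup>2 \<le> x"
  unfolding norm_dirichlet_h2_sq by (rule suminf_le_const[OF h2_summable assms])

section \<open>Compactness through approximation by finite rank\<close>

lemma compact_closure_totally_bounded:
  fixes S :: "'a :: complete_space set"
  assumes "\<And>e. e > 0 \<Longrightarrow> \<exists>K. compact K \<and> (\<forall>x\<in>S. \<exists>y\<in>K. dist x y < e)"
  shows "compact (closure S)"
  unfolding compact_eq_totally_bounded
proof (intro conjI allI impI)
  show "complete (closure S)" by (simp add: complete_eq_closed)
  fix e :: real assume e: "e > 0"
  then obtain K where K: "compact K" "\<And>x. x \<in> S \<Longrightarrow> \<exists>y\<in>K. dist x y < e / 4"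
    using assms[of "e / 4"] by auto
  obtain k where k: "finite k" "K \<subseteq> (\<Union>x\<in>k. ball x (e / 4))"
    using K(1) e unfolding compact_eq_totally_bounded by (metis divide_pos_pos zero_less_numeral)
  have "closure S \<subseteq> (\<Union>x\<in>k. ball x e)"
  proof
    fix x assume "x \<in> closure S"
    then obtain y where y: "y \<in> S" "dist y x < e / 4"
      using e unfolding closure_approachable by (metis divide_pos_pos zero_less_numeral)
    obtain z where z: "z \<in> K" "dist y z < e / 4" using K(2)[OF y(1)] by auto
    obtain w where w: "w \<in> k" "dist w z < e / 4" using k(2) z(1) by auto
    have "dist w x \<le> dist w z + dist y z + dist y x"
      using dist_triangle[of w x z] dist_triangle[of z x y] by (simp add: dist_commute)
    then have "dist w x < e" using y z w e by simp
    with w(1) show "x \<in> (\<Union>x\<in>k. ball x e)" by auto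
  qed
  with k(1) show "\<exists>k. finite k \<and> closure S \<subseteq> (\<Union>x\<in>k. ball x e)" by blast
qed

text \<open>The space carries real scalars only, so a complex coefficient is split into two real
  ones; v and w will be the images of a basis vector and of its multiple by the imaginary
  unit.\<close>

lemma compact_bounded_combinations:
  fixes v w :: "nat \<Rightarrow> 'a :: real_normed_vector"
  shows "\<exists>K. compact K \<and> (\<forall>x y. (\<forall>n. \<bar>x n\<bar> \<le> 1 \<and> \<bar>y n\<bar> \<le> 1) \<longrightarrow> (\<Sum>n<N. x n *\<^sub>R v n + y n *\<^sub>R w n) \<in> K)"
proof (induction N)
  case 0
  show ?case by (rule exI[of _ "{0}"]) auto
next
  case (Suc N)
  then obtain K where K: "compact K"
    "\<And>x y. (\<And>n. \<bar>x n\<bar> \<le> 1 \<and> \<bar>y n\<bar> \<le> 1) \<Longrightarrow> (\<Sum>n<N. x n *\<^sub>R v n + y n *\<^sub>R w n) \<in> K"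
    by blast
  define Z where "Z = (\<lambda>(a :: real, b :: real). a *\<^sub>R v N + b *\<^sub>R w N) ` ({-1..1} \<times> {-1..1})"
  have "compact Z" unfolding Z_def case_prod_beta
    by (intro compact_continuous_image compact_Times continuous_intros) auto
  then have "compact {x + y | x y. x \<in> K \<and> y \<in> Z}" by (intro compact_sums K)
  moreover have "(\<Sum>n<Suc N. x n *\<^sub>R v n + y n *\<^sub>R w n) \<in> {x + y | x y. x \<in> K \<and> y \<in> Z}"
    if "\<forall>n. \<bar>x n\<bar> \<le> 1 \<and> \<bar>y n\<bar> \<le> 1" for x y
  proof -
    have "x N *\<^sub>R v N + y N *\<^sub>R w N \<in> Z"
      unfolding Z_def using that by (intro image_eqI[of _ _ "(x N, y N)"]) (auto simp: abs_le_iff)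
    with K(2)[of x y] that show ?thesis by auto
  qed
  ultimately show ?case by blast
qed

text \<open>The synthesis bound on indices from M on has norm squared at most the supremum of W
  there. Hence the images of the partial sums of f form a Cauchy sequence, their limit defines the
  operator, and cutting off at M approximates it uniformly on the unit ball. Continuity of point
  evaluations identifies the limit with the composition.\<close>

lemma compact_composition_operator_if_expansion:
  assumes exp: "composition_expansion S B \<phi> W" and "0 \<notin> S"
    and W: "\<And>n. W n \<ge> 0" "W \<longlonglongrightarrow> 0"
    and \<phi>: "\<And>s. Re s > 1/2 \<Longrightarrow> Re (\<phi> s) > 1/2"
  shows "compact_composition_operator \<phi>"
proof -
  obtain C where C: "C > 0" "\<And>n. W n \<le> C"
    using convergent_imp_Bseq[OF convergentI[OF W(2)]] unfolding Bseq_def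
    by (metis abs_le_iff real_norm_def)
  \<comment> \<open>Extension by zero gives coefficients indexed by all naturals;
    \<open>0 \<notin> S\<close> then provides the vanishing coefficient at index 0 that the type
    demands.\<close>
  define D where "D n l = (if l \<in> S then B n l else 0)" for n l
  have bound: "(\<Sum>l\<in>L. (norm (\<Sum>n\<in>F. a n * D n l))\<^sup>2) \<le> (\<Sum>n\<in>F. (norm (a n))\<^sup>2 * W n)"
    if "finite F" "finite L" for F L a
  proof -
    have "(\<Sum>l\<in>L. (norm (\<Sum>n\<in>F. a n * D n l))\<^sup>2) = (\<Sum>l\<in>L \<inter> S. (norm (\<Sum>n\<in>F. a n * B n l))\<^sup>2)"
      using that by (intro sum.mono_neutral_cong_right) (auto simp: D_def)
    also have "\<dots> \<le> (\<Sum>n\<in>F. (norm (a n))\<^sup>2 * W n)"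
      using exp that by (auto simp: composition_expansion_def)
    finally show ?thesis .
  qed
  have D_sums: "(\<lambda>l. D n l * of_nat l powr (- s)) sums of_nat n powr (- \<phi> s)" if "Re s > 0" for n s
  proof (rule has_sum_imp_sums)
    have "((\<lambda>l. B n l * of_nat l powr (- s)) has_sum of_nat n powr (- \<phi> s)) S"
      using exp that by (auto simp: composition_expansion_def)
    then show "((\<lambda>l. D n l * of_nat l powr (- s)) has_sum of_nat n powr (- \<phi> s)) UNIV"
      by (rule has_sum_cong_neutral[THEN iffD1, rotated -1]) (auto simp: D_def)
  qed
  have D_in: "(\<lambda>l. \<Sum>n\<in>F. a n * D n l) \<in> {a. a 0 = 0 \<and> summable (\<lambda>n. (norm (a n))\<^sup>2)}"
    if "finite F" for F a
    using \<open>0 \<notin> S\<close> that bound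
    by (auto intro!: bounded_imp_summable[where B = "\<Sum>n\<in>F. (norm (a n))\<^sup>2 * W n"] simp: D_def)
  define G where "G a N = Abs_dirichlet_h2 (\<lambda>l. \<Sum>n<N. a n * D n l)" for a :: "nat \<Rightarrow> complex" and N
  have G: "h2_coeff (G a N) l = (\<Sum>n<N. a n * D n l)" for a N l
    unfolding G_def by (subst Abs_dirichlet_h2_inverse[OF D_in]) auto
  have G_diff: "(norm (G a N - G a M))\<^sup>2 \<le> (\<Sum>n=M..<N. (norm (a n))\<^sup>2 * W n)" if "M \<le> N" for a M N
  proof (rule norm_h2_sq_le)
    fix K
    have "h2_coeff (G a N - G a M) l = (\<Sum>n=M..<N. a n * D n l)" for l
      using sum_diff_nat_ivl[of 0 M N "\<lambda>n. a n * D n l"] that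
      by (simp add: minus_dirichlet_h2.rep_eq G atLeast0LessThan)
    then show "(\<Sum>l<K. (norm (h2_coeff (G a N - G a M) l))\<^sup>2) \<le> (\<Sum>n=M..<N. (norm (a n))\<^sup>2 * W n)"
      using bound by simp
  qed
  have coeff_sum: "(\<Sum>n=M..<N. (norm (h2_coeff f n))\<^sup>2) \<le> (norm f)\<^sup>2" for f M N
  proof -
    have "(\<Sum>n=M..<N. (norm (h2_coeff f n))\<^sup>2) \<le> (\<Sum>n<N. (norm (h2_coeff f n))\<^sup>2)"
      by (intro sum_mono2) auto
    also have "\<dots> \<le> (norm f)\<^sup>2" by (rule sum_norm_coeff_sq_le)
    finally show ?thesis .
  qed
  have G_tail: "(norm (G (h2_coeff f) N - G (h2_coeff f) M))\<^sup>2 \<le> e * (norm f)\<^sup>2"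
    if "M \<le> N" "\<And>n. n \<ge> M \<Longrightarrow> W n \<le> e" "e \<ge> 0" for f M N e
  proof -
    have "(norm (G (h2_coeff f) N - G (h2_coeff f) M))\<^sup>2 \<le> (\<Sum>n=M..<N. (norm (h2_coeff f n))\<^sup>2 * e)"
      using that by (intro order_trans[OF G_diff] sum_mono mult_left_mono) auto
    also have "\<dots> = e * (\<Sum>n=M..<N. (norm (h2_coeff f n))\<^sup>2)"
      by (simp add: sum_distrib_left mult.commute)
    also have "\<dots> \<le> e * (norm f)\<^sup>2" using coeff_sum \<open>e \<ge> 0\<close> by (intro mult_left_mono)
    finally show ?thesis .
  qed
  have G_tail': "norm (G (h2_coeff f) N - G (h2_coeff f) M) \<le> e * norm f"
    if "M \<le> N" "\<And>n. n \<ge> M \<Longrightarrow> W n \<le> e\<^sup>2" "e \<ge> 0" for f M N e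
    by (rule power2_le_imp_le) (use G_tail[of M N "e\<^sup>2" f] that in \<open>auto simp: power_mult_distrib\<close>)
  have W_small: "\<exists>M. \<forall>n\<ge>M. W n \<le> e\<^sup>2" if "e > 0" for e
  proof -
    have "\<forall>\<^sub>F n in sequentially. W n < e\<^sup>2"
      by (rule order_tendstoD(2)[OF W(2)]) (use that in simp)
    then show ?thesis unfolding eventually_sequentially by (meson less_imp_le)
  qed
  have "Cauchy (G (h2_coeff f))" for f
  proof (rule CauchyI)
    fix e :: real assume e: "e > 0"
    define e' where "e' = e / (4 * (norm f + 1))"
    have f1: "norm f + 1 > 0" by (simp add: add_nonneg_pos)
    then have e': "e' > 0" using e by (simp add: e'_def)
    then obtain M where M: "\<And>n. n \<ge> M \<Longrightarrow> W n \<le> e'\<^sup>2" using W_small by blast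
    have "e' * norm f \<le> e' * (norm f + 1)" using e' by (intro mult_left_mono) auto
    also have "\<dots> = e / 4" using f1 by (simp add: e'_def divide_simps)
    finally have 1: "norm (G (h2_coeff f) N - G (h2_coeff f) M) \<le> e / 4" if "N \<ge> M" for N
      using G_tail'[of M N e' f] that M e' by simp
    have "norm (G (h2_coeff f) i - G (h2_coeff f) j) < e" if "i \<ge> M" "j \<ge> M" for i j
      using 1[OF that(1)] 1[OF that(2)] e
        norm_triangle_ineq4[of "G (h2_coeff f) i - G (h2_coeff f) M" "G (h2_coeff f) j - G (h2_coeff f) M"]
      by simp
    then show "\<exists>M. \<forall>m\<ge>M. \<forall>n\<ge>M. norm (G (h2_coeff f) m - G (h2_coeff f) n) < e" by blast
  qed
  then have "\<exists>g. G (h2_coeff f) \<longlonglongrightarrow> g" for f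
    using Cauchy_convergent convergent_def by blast
  then obtain T where T: "\<And>f. G (h2_coeff f) \<longlonglongrightarrow> T f" by metis
  have T_tail: "norm (T f - G (h2_coeff f) M) \<le> e * norm f"
    if "\<And>n. n \<ge> M \<Longrightarrow> W n \<le> e\<^sup>2" "e \<ge> 0" for f M e
  proof (rule tendsto_upperbound)
    show "(\<lambda>N. norm (G (h2_coeff f) N - G (h2_coeff f) M)) \<longlonglongrightarrow> norm (T f - G (h2_coeff f) M)"
      by (intro tendsto_intros T)
    have "norm (G (h2_coeff f) N - G (h2_coeff f) M) \<le> e * norm f" if "N \<ge> M" for N
      using that by (intro G_tail' \<open>\<And>n. n \<ge> M \<Longrightarrow> W n \<le> e\<^sup>2\<close> \<open>e \<ge> 0\<close>)
    then show "\<forall>\<^sub>F N in sequentially. norm (G (h2_coeff f) N - G (h2_coeff f) M) \<le> e * norm f"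
      by (auto simp: eventually_sequentially)
  qed simp
  have "is_composition_operator \<phi> T"
    unfolding is_composition_operator_def
  proof (intro allI ballI)
    fix f s assume "s \<in> right_halfplane (1/2)"
    then have s: "Re s > 1/2" by (simp add: right_halfplane_def)
    have "h2_eval (G (h2_coeff f) N) s = (\<Sum>n<N. h2_coeff f n * of_nat n powr (- \<phi> s))" for N
    proof -
      have "(\<lambda>l. \<Sum>n<N. h2_coeff f n * (D n l * of_nat l powr (- s))) sums (\<Sum>n<N. h2_coeff f n * of_nat n powr (- \<phi> s))"
        using s by (intro sums_sum sums_mult D_sums) auto
      then show ?thesis
        using sums_unique2[OF h2_eval_sums[OF s]] by (simp add: G sum_distrib_right mult.assoc)
    qed
    then have "(\<lambda>N. h2_eval (G (h2_coeff f) N) s) \<longlonglongrightarrow> h2_eval f (\<phi> s)"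
      using h2_eval_sums[OF \<phi>[OF s], of f] by (simp add: sums_def)
    with h2_eval_tendsto[OF s T] show "h2_eval (T f) s = h2_eval f (\<phi> s)"
      by (rule LIMSEQ_unique)
  qed
  moreover have "bounded_linear T"
  proof (rule bounded_linear_intro[where K = "sqrt C"])
    fix f g :: dirichlet_h2 and r :: real
    have "G (h2_coeff (f + g)) N = G (h2_coeff f) N + G (h2_coeff g) N" for N
      by (simp add: h2_coeff_inject[symmetric] fun_eq_iff plus_dirichlet_h2.rep_eq G sum.distrib distrib_right)
    then have "G (h2_coeff (f + g)) = (\<lambda>N. G (h2_coeff f) N + G (h2_coeff g) N)"
      by (rule ext)
    then show "T (f + g) = T f + T g"
      using tendsto_add[OF T[of f] T[of g]] by (intro LIMSEQ_unique[OF T[of "f + g"]]) simp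
    have "G (h2_coeff (r *\<^sub>R f)) N = r *\<^sub>R G (h2_coeff f) N" for N
      by (simp add: h2_coeff_inject[symmetric] fun_eq_iff scaleR_dirichlet_h2.rep_eq G scaleR_sum_right)
    then have "G (h2_coeff (r *\<^sub>R f)) = (\<lambda>N. r *\<^sub>R G (h2_coeff f) N)"
      by (rule ext)
    then show "T (r *\<^sub>R f) = r *\<^sub>R T f"
      using tendsto_scaleR[OF tendsto_const T[of f], of r]
      by (intro LIMSEQ_unique[OF T[of "r *\<^sub>R f"]]) simp
    have "G (h2_coeff f) 0 = 0"
      by (simp add: h2_coeff_inject[symmetric] fun_eq_iff zero_dirichlet_h2.rep_eq G)
    \<comment> \<open>The tail estimate with cut-off 0 is the bound for the whole operator.\<close>
    then show "norm (T f) \<le> norm f * sqrt C"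
      using T_tail[of 0 "sqrt C" f] C by (simp add: mult.commute)
  qed
  moreover have "compact (closure (T ` cball 0 1))"
  proof (rule compact_closure_totally_bounded)
    fix e :: real assume e: "e > 0"
    obtain M where M: "\<And>n. n \<ge> M \<Longrightarrow> W n \<le> (e / 2)\<^sup>2"
      using W_small[of "e / 2"] e by auto
    define v where "v n = Abs_dirichlet_h2 (\<lambda>l. \<Sum>k\<in>{n}. 1 * D k l)" for n
    define w where "w n = Abs_dirichlet_h2 (\<lambda>l. \<Sum>k\<in>{n}. \<i> * D k l)" for n
    have v: "h2_coeff (v n) l = D n l" for n l
      unfolding v_def by (subst Abs_dirichlet_h2_inverse[OF D_in]) auto
    have w: "h2_coeff (w n) l = \<i> * D n l" for n l
      unfolding w_def by (subst Abs_dirichlet_h2_inverse[OF D_in]) auto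
    obtain K where K: "compact K" "\<And>x y. (\<And>n. \<bar>x n\<bar> \<le> 1 \<and> \<bar>y n\<bar> \<le> 1) \<Longrightarrow> (\<Sum>n<M. x n *\<^sub>R v n + y n *\<^sub>R w n) \<in> K"
      using compact_bounded_combinations[where N = M and v = v and w = w] by blast
    have h2_sum: "h2_coeff (\<Sum>n<N. g n) l = (\<Sum>n<N. h2_coeff (g n) l)" for g l and N :: nat
      by (induction N) (auto simp: zero_dirichlet_h2.rep_eq plus_dirichlet_h2.rep_eq)
    have "\<exists>y\<in>K. dist (T f) y < e" if "norm f \<le> 1" for f
    proof
      have "G (h2_coeff f) M = (\<Sum>n<M. Re (h2_coeff f n) *\<^sub>R v n + Im (h2_coeff f n) *\<^sub>R w n)"
        by (auto simp: h2_coeff_inject[symmetric] fun_eq_iff h2_sum G v w plus_dirichlet_h2.rep_eq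
            scaleR_dirichlet_h2.rep_eq complex_eq_iff intro!: sum.cong)
      moreover have "\<bar>Re (h2_coeff f n)\<bar> \<le> 1 \<and> \<bar>Im (h2_coeff f n)\<bar> \<le> 1" for n
        using norm_coeff_le[of f n] that abs_Re_le_cmod[of "h2_coeff f n"] abs_Im_le_cmod[of "h2_coeff f n"] by linarith
      ultimately show "G (h2_coeff f) M \<in> K" using K(2) by metis
      have "norm (T f - G (h2_coeff f) M) \<le> e / 2 * norm f"
        using M e by (intro T_tail) auto
      also have "\<dots> \<le> e / 2 * 1" using that e by (intro mult_left_mono) auto
      finally show "dist (T f) (G (h2_coeff f) M) < e" using e by (simp add: dist_norm)
    qed
    with K(1) show "\<exists>K. compact K \<and> (\<forall>x\<in>T ` cball 0 1. \<exists>y\<in>K. dist x y < e)"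
      by (intro exI[of _ K]) auto
  qed
  ultimately show ?thesis
    unfolding compact_composition_operator_def compact_operator_def by blast
qed

section \<open>The range of the symbol\<close>

text \<open>Kronecker's theorem for the frequencies \<open>ln (q j) / (2 * pi)\<close> finds a real
  t whose multiples are close, modulo integers, to the prescribed angles. The angles carry a minus
  sign because the exponent is \<open>- \<i> t\<close>.\<close>

lemma Kronecker_log_approx:
  fixes q :: "nat \<Rightarrow> nat" and d :: nat
  assumes "inj_on q {1..d}" "rat_independent_integers (q ` {1..d})" "\<epsilon> > 0"
    and z: "\<And>j. j \<in> {1..d} \<Longrightarrow> norm (z j) = 1"
  obtains t where "\<And>j. j \<in> {1..d} \<Longrightarrow> norm (of_nat (q j) powr (- (\<i> * of_real t)) - z j) < \<epsilon>"
proof -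
  \<comment> \<open>The index is shifted because the theorem counts from 0; after division by
    \<open>2 * pi\<close> its integer parts become full turns.\<close>
  define \<theta> where "\<theta> i = ln (real (q (Suc i))) / (2 * pi)" for i
  define \<alpha> where "\<alpha> i = - Arg (z (Suc i)) / (2 * pi)" for i
  have q2: "q j \<ge> 2" if "j \<in> {1..d}" for j
    using assms(2) that by (force simp: rat_independent_integers_def)
  have inj: "inj_on \<theta> {..<d}"
  proof (rule inj_onI)
    fix i j assume *: "i \<in> {..<d}" "j \<in> {..<d}" "\<theta> i = \<theta> j"
    then have "q (Suc i) = q (Suc j)" using q2[of "Suc i"] q2[of "Suc j"] by (simp add: \<theta>_def)
    with * assms(1) show "i = j" by (auto dest!: inj_onD)
  qed
  interpret Z: Modules.module "(\<lambda>r. (*) (real_of_int r))"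
    by (simp add: Modules.module.intro distrib_left mult.commute)
  have "Z.independent (\<theta> ` {..<d})"
    unfolding Z.independent_explicit_module
  proof (intro allI impI)
    fix S :: "real set" and u :: "real \<Rightarrow> int" and v
    assume S: "finite S" "S \<subseteq> \<theta> ` {..<d}" "(\<Sum>v\<in>S. of_int (u v) * v) = 0" "v \<in> S"
    define c where "c j = (if \<theta> (j - 1) \<in> S then u (\<theta> (j - 1)) else 0)" for j
    obtain i where i: "i < d" "v = \<theta> i" using S by auto
    have "(\<Sum>j=1..d. of_int (c j) * ln (real (q j))) = (\<Sum>i<d. of_int (c (Suc i)) * (2 * pi * \<theta> i))"
      by (rule sum.reindex_bij_witness[of _ Suc "\<lambda>j. j - 1"]) (auto simp: \<theta>_def)
    also have "\<dots> = 2 * pi * (\<Sum>i<d. of_int (c (Suc i)) * \<theta> i)"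
      by (simp add: sum_distrib_left mult_ac)
    also have "(\<Sum>i<d. of_int (c (Suc i)) * \<theta> i) = (\<Sum>v\<in>\<theta> ` {..<d}. of_int (if v \<in> S then u v else 0) * v)"
      by (subst sum.reindex[OF inj]) (auto simp: c_def intro!: sum.cong)
    also have "\<dots> = (\<Sum>v\<in>S. of_int (u v) * v)"
      using S by (intro sum.mono_neutral_cong_right) auto
    finally have "(\<Sum>j=1..d. of_int (c j) * ln (real (q j))) = 0" using S by simp
    then have "c (Suc i) = 0"
      using i by (intro rat_independent_integersD[OF assms(1,2)]) auto
    then show "u v = 0" using i S by (simp add: c_def)
  qed
  moreover have "\<epsilon> / (2 * pi) > 0" using assms(3) by simp
  ultimately obtain t h where th: "\<And>i. i < d \<Longrightarrow> \<bar>t * \<theta> i - of_int (h i) - \<alpha> i\<bar> < \<epsilon> / (2 * pi)"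
    using Kronecker_thm_1[OF _ inj] by metis
  show thesis
  proof (rule that[of t])
    fix j assume j: "j \<in> {1..d}"
    define i where "i = j - 1"
    have i: "i < d" "j = Suc i" using j by (auto simp: i_def)
    define \<eta> where "\<eta> = t * \<theta> i - of_int (h i) - \<alpha> i"
    have ln: "t * ln (real (q j)) = 2 * pi * (\<eta> + of_int (h i) + \<alpha> i)"
      by (simp add: \<eta>_def \<theta>_def i)
    have zj: "z j = exp (\<i> * of_real (Arg (z j)))"
      using z[OF j] by (metis Arg_eq Arg_zero norm_zero mult_1 of_real_1 zero_neq_one)
    have "of_nat (q j) powr (- (\<i> * of_real t)) = exp (- (\<i> * of_real (t * ln (real (q j)))))"
      using q2[OF j] by (simp add: of_nat_powr mult.assoc)
    also have "- (\<i> * of_real (t * ln (real (q j)))) =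
        \<i> * of_real (Arg (z j)) + (\<i> * of_real (- 2 * pi * \<eta>) - 2 * of_int (h i) * of_real pi * \<i>)"
      unfolding ln by (simp add: \<alpha>_def i algebra_simps)
    also have "exp \<dots> = z j * exp (\<i> * of_real (- 2 * pi * \<eta>))"
    proof -
      have "exp (2 * of_int (h i) * of_real pi * \<i>) = 1"
        using exp_integer_2pi[of "of_int (h i)"] by (simp add: mult_ac)
      then show ?thesis by (subst exp_add, subst exp_diff) (simp add: zj[symmetric])
    qed
    finally have "of_nat (q j) powr (- (\<i> * of_real t)) - z j = z j * (exp (\<i> * of_real (- 2 * pi * \<eta>)) - 1)"
      by (simp add: algebra_simps)
    then have "norm (of_nat (q j) powr (- (\<i> * of_real t)) - z j) = norm (exp (\<i> * of_real (- 2 * pi * \<eta>)) - 1)"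
      using z[OF j] by (simp add: norm_mult)
    also have "\<dots> = 2 * \<bar>sin (- 2 * pi * \<eta> / 2)\<bar>" by (rule dist_exp_i_1)
    also have "\<dots> \<le> 2 * \<bar>- 2 * pi * \<eta> / 2\<bar>" by (intro mult_left_mono abs_sin_x_le_abs_x) auto
    also have "\<dots> = 2 * pi * \<bar>\<eta>\<bar>" by (simp add: abs_mult)
    also have "\<dots> < \<epsilon>" using th[OF i(1)] by (simp add: \<eta>_def pos_less_divide_eq mult.commute)
    finally show "norm (of_nat (q j) powr (- (\<i> * of_real t)) - z j) < \<epsilon>" .
  qed
qed

text \<open>The approximating points lie on the line \<open>Re s = 0\<close>. Moving them right by 1
  / (k + 1) multiplies each coordinate by a factor tending to 1.\<close>

lemma torus_point_is_limit:
  fixes q :: "nat \<Rightarrow> nat" and d :: nat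
  assumes "inj_on q {1..d}" "rat_independent_integers (q ` {1..d})"
    and z: "\<And>j. j \<in> {1..d} \<Longrightarrow> norm (z j) = 1"
  obtains s where "\<And>k :: nat. Re (s k) > 0"
    "\<And>j. j \<in> {1..d} \<Longrightarrow> (\<lambda>k. of_nat (q j) powr (- s k)) \<longlonglongrightarrow> z j"
proof -
  have q2: "q j \<ge> 2" if "j \<in> {1..d}" for j
    using assms(2) that by (force simp: rat_independent_integers_def)
  have "\<exists>t. \<forall>j\<in>{1..d}. norm (of_nat (q j) powr (- (\<i> * of_real t)) - z j) < inverse (real (Suc k))" for k
  proof -
    have "inverse (real (Suc k)) > 0" by simp
    then obtain t where "\<And>j. j \<in> {1..d} \<Longrightarrow>
        norm (of_nat (q j) powr (- (\<i> * of_real t)) - z j) < inverse (real (Suc k))"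
      using Kronecker_log_approx[where q = q and d = d and z = z, OF assms(1,2) _ z] by metis
    then show ?thesis by blast
  qed
  then obtain t where t: "\<And>k j. j \<in> {1..d} \<Longrightarrow>
      norm (of_nat (q j) powr (- (\<i> * of_real (t k))) - z j) < inverse (real (Suc k))"
    by metis
  show thesis
  proof (rule that[of "\<lambda>k. of_real (inverse (real (Suc k))) + \<i> * of_real (t k)"])
    fix j assume j: "j \<in> {1..d}"
    have 1: "(\<lambda>k. of_nat (q j) powr (- (\<i> * of_real (t k)))) \<longlonglongrightarrow> z j"
      by (rule LIM_zero_cancel, rule Lim_null_comparison[OF _ LIMSEQ_inverse_real_of_nat])
         (use t[OF j] in \<open>auto intro!: always_eventually less_imp_le\<close>)
    have "(\<lambda>k. exp (- (complex_of_real (inverse (real (Suc k)))) * of_real (ln (real (q j)))))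
        \<longlonglongrightarrow> exp (- (of_real 0) * of_real (ln (real (q j))))"
      by (intro tendsto_intros LIMSEQ_inverse_real_of_nat)
    then have 2: "(\<lambda>k. of_nat (q j) powr (- complex_of_real (inverse (real (Suc k))))) \<longlonglongrightarrow> 1"
      using q2[OF j] by (simp add: of_nat_powr)
    have "of_nat (q j) powr (- (of_real (inverse (real (Suc k))) + \<i> * of_real (t k))) =
        of_nat (q j) powr (- of_real (inverse (real (Suc k)))) * of_nat (q j) powr (- (\<i> * of_real (t k)))" for k
      by (simp add: powr_add[symmetric] del: of_real_inverse)
    then show "(\<lambda>k. of_nat (q j) powr (- (of_real (inverse (real (Suc k))) + \<i> * of_real (t k)))) \<longlonglongrightarrow> z j"
      using tendsto_mult[OF 2 1] by simp
  qed simp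
qed

lemma poly_Re_circle_min:
  obtains z where "norm z = 1" "\<And>w. norm w = 1 \<Longrightarrow> Re (poly P z) \<le> Re (poly P w)"
proof -
  have "\<exists>x\<in>sphere (0 :: complex) 1. \<forall>y\<in>sphere 0 1. Re (poly P x) \<le> Re (poly P y)"
    by (rule continuous_attains_inf) (auto intro!: continuous_intros)
  with that show thesis by (auto simp: dist_norm)
qed

text \<open>Boundedness will exclude a positive characteristic.\<close>

lemma bounded_polynomial_symbol:
  fixes P :: "nat \<Rightarrow> complex poly"
  obtains K where "\<And>s. Re s > 0 \<Longrightarrow> norm (\<Sum>j=1..d. poly (P j) (of_nat (q j) powr (- s))) \<le> K"
proof -
  have "\<exists>K. \<forall>z. norm z \<le> 1 \<longrightarrow> norm (poly (P j) z) \<le> K" for j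
  proof -
    have "bounded (poly (P j) ` cball 0 1)"
      by (intro compact_imp_bounded compact_continuous_image continuous_intros) auto
    then obtain K where "\<forall>x\<in>poly (P j) ` cball 0 1. norm x \<le> K"
      unfolding bounded_iff by blast
    then show ?thesis by (intro exI[of _ K]) auto
  qed
  then obtain K where K: "\<And>j z. norm z \<le> 1 \<Longrightarrow> norm (poly (P j) z) \<le> K j" by metis
  have "norm (\<Sum>j=1..d. poly (P j) (of_nat (q j) powr (- s))) \<le> (\<Sum>j=1..d. K j)" if "Re s > 0" for s
    using that by (intro order_trans[OF norm_sum] sum_mono K norm_nat_powr_le_1) auto
  then show thesis by (rule that)
qed

text \<open>The class provides the Dirichlet series only with an unknown characteristic and only for
  \<open>Re s > 1/2\<close>. Both the symbol and the series are bounded there, the latter by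
  comparison with one partial sum, so the linear term must vanish. The identity theorem then extends
  the equality to \<open>Re s > 0\<close>, where the range condition holds.\<close>

lemma polynomial_symbol_range:
  fixes P :: "nat \<Rightarrow> complex poly"
  assumes \<phi>: "\<And>s. \<phi> s = (\<Sum>j=1..d. poly (P j) (of_nat (q j) powr (- s)))"
    and "\<phi> \<in> gordon_hedenmalm" and q: "\<And>j. j \<in> {1..d} \<Longrightarrow> q j > 0"
    and s: "Re s > 0"
  shows "Re (\<phi> s) > 1/2"
proof -
  obtain c0 c where
    eq: "\<And>s. Re s > 1/2 \<Longrightarrow> \<phi> s = of_nat c0 * s + dirichlet_series c s"
    and ul: "\<And>\<epsilon>. \<epsilon> > 0 \<Longrightarrow> uniform_limit (right_halfplane \<epsilon>)
          (\<lambda>N s. \<Sum>n=1..N. c n * of_nat n powr (- s)) (dirichlet_series c) sequentially"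
    and c0: "c0 = 0 \<Longrightarrow> dirichlet_series c ` right_halfplane 0 \<subseteq> right_halfplane (1/2)"
    using assms(2) by (auto simp: gordon_hedenmalm_def gordon_hedenmalm_with_characteristic_def right_halfplane_def)
  have "c0 = 0"
  proof (rule ccontr)
    assume "c0 \<noteq> 0"
    obtain K where K: "\<And>s. Re s > 0 \<Longrightarrow> norm (\<phi> s) \<le> K"
      using bounded_polynomial_symbol[where d = d and P = P and q = q] unfolding \<phi> by metis
    have "\<forall>\<^sub>F N in sequentially. \<forall>s\<in>right_halfplane (1/2).
        dist (\<Sum>n=1..N. c n * of_nat n powr (- s)) (dirichlet_series c s) < 1"
      using ul[of "1/2"] by (simp add: uniform_limit_iff)
    then obtain N where N: "\<And>s. Re s > 1/2 \<Longrightarrow>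
        dist (\<Sum>n=1..N. c n * of_nat n powr (- s)) (dirichlet_series c s) < 1"
      by (auto simp: eventually_sequentially right_halfplane_def)
    define L where "L = (\<Sum>n=1..N. norm (c n))"
    have L: "norm (\<Sum>n=1..N. c n * of_nat n powr (- s)) \<le> L" if "Re s > 1/2" for s
      unfolding L_def using that
      by (intro order_trans[OF norm_sum] sum_mono) (auto simp: norm_mult intro!: mult_left_le norm_nat_powr_le_1)
    define x where "x = \<bar>K\<bar> + \<bar>L\<bar> + 2"
    have x: "x > 1/2" by (simp add: x_def)
    have "x \<le> real c0 * x" using \<open>c0 \<noteq> 0\<close> x by simp
    also have "\<dots> = norm (of_nat c0 * complex_of_real x)" using x by (simp add: norm_mult)
    also have "of_nat c0 * complex_of_real x = \<phi> x - dirichlet_series c x"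
      using eq[of "of_real x"] x by simp
    also have "norm \<dots> \<le> norm (\<phi> x) + norm (dirichlet_series c x)" by (rule norm_triangle_ineq4)
    also have "\<dots> \<le> K + (L + 1)"
    proof (rule add_mono)
      show "norm (\<phi> x) \<le> K" using x by (intro K) auto
      show "norm (dirichlet_series c x) \<le> L + 1"
        using N[of "of_real x"] L[of "of_real x"] x
          norm_triangle_sub[of "dirichlet_series c x" "\<Sum>n=1..N. c n * of_nat n powr (- of_real x)"]
        by (simp add: dist_norm norm_minus_commute)
    qed
    also have "\<dots> < x" by (simp add: x_def)
    finally show False by simp
  qed
  have open_rhp: "open (right_halfplane \<theta>)" for \<theta>
    unfolding right_halfplane_def by (rule open_halfspace_Re_gt)
  have hol1: "dirichlet_series c holomorphic_on right_halfplane 0"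
  proof (rule holomorphic_uniform_sequence[OF open_rhp])
    have "(\<lambda>s. of_nat n powr (- s)) holomorphic_on right_halfplane 0" if "n \<ge> 1" for n :: nat
      using that by (simp add: of_nat_powr) (intro holomorphic_intros)
    then show "(\<lambda>s. \<Sum>n=1..N. c n * of_nat n powr (- s)) holomorphic_on right_halfplane 0" for N
      by (intro holomorphic_intros) auto
    fix x assume x: "x \<in> right_halfplane 0"
    have sub: "cball x (Re x / 2) \<subseteq> right_halfplane (Re x / 4)"
    proof
      fix y assume "y \<in> cball x (Re x / 2)"
      then have "Re x - Re y \<le> Re x / 2"
        using complex_Re_le_cmod[of "x - y"] by (simp add: dist_norm)
      then show "y \<in> right_halfplane (Re x / 4)" using x by (simp add: right_halfplane_def)
    qed
    have "uniform_limit (cball x (Re x / 2)) (\<lambda>N s. \<Sum>n=1..N. c n * of_nat n powr (- s)) (dirichlet_series c) sequentially"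
      using uniform_limit_on_subset[OF ul sub] x by (simp add: right_halfplane_def)
    moreover have "cball x (Re x / 2) \<subseteq> right_halfplane 0"
      using sub x by (force simp: right_halfplane_def)
    ultimately show "\<exists>d>0. cball x d \<subseteq> right_halfplane 0 \<and> uniform_limit (cball x d) (\<lambda>N s. \<Sum>n=1..N. c n * of_nat n powr (- s)) (dirichlet_series c) sequentially"
      using x by (intro exI[of _ "Re x / 2"]) (auto simp: right_halfplane_def)
  qed
  have hol2: "\<phi> holomorphic_on right_halfplane 0"
  proof -
    have "(\<lambda>s. of_nat (q j) powr (- s)) holomorphic_on right_halfplane 0" if "j \<in> {1..d}" for j
      using q[OF that] by (simp add: of_nat_powr) (intro holomorphic_intros)
    then show ?thesis unfolding \<phi>[abs_def] by (intro holomorphic_intros)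
  qed
  have "connected (right_halfplane 0)"
    unfolding right_halfplane_def by (intro convex_connected convex_halfspace_Re_gt)
  moreover have "right_halfplane (1/2) \<noteq> {}"
    unfolding right_halfplane_def by (auto intro: exI[of _ 1])
  ultimately have "\<phi> s = dirichlet_series c s"
    by (rule_tac analytic_continuation_open[where s = "right_halfplane (1/2)" and z = s, OF open_rhp open_rhp _ _ _ hol2 hol1])
       (use s eq \<open>c0 = 0\<close> in \<open>auto simp: right_halfplane_def\<close>)
  then show ?thesis using c0[OF \<open>c0 = 0\<close>] s by (auto simp: right_halfplane_def)
qed

text \<open>Each summand is at least its circle minimum by the maximum principle, and the limit
  points of the torus let all the variables approach their minimisers simultaneously. Every value
  along that sequence exceeds 1/2, hence the second claim.\<close>

lemma polynomial_symbol_infimum: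
  fixes P :: "nat \<Rightarrow> complex poly"
  assumes "inj_on q {1..d}" "rat_independent_integers (q ` {1..d})"
    and \<phi>: "\<And>s. \<phi> s = (\<Sum>j=1..d. poly (P j) (of_nat (q j) powr (- s)))"
    and "\<phi> \<in> gordon_hedenmalm"
    and z: "\<And>j. j \<in> {1..d} \<Longrightarrow> norm (z j) = 1"
      "\<And>j w. j \<in> {1..d} \<Longrightarrow> norm w = 1 \<Longrightarrow> Re (poly (P j) (z j)) \<le> Re (poly (P j) w)"
  shows "(INF s\<in>right_halfplane 0. Re (\<phi> s)) = (\<Sum>j=1..d. Re (poly (P j) (z j)))"
    and "(\<Sum>j=1..d. Re (poly (P j) (z j))) \<ge> 1/2"
proof -
  define m where "m = (\<Sum>j=1..d. Re (poly (P j) (z j)))"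
  obtain s where s: "\<And>k :: nat. Re (s k) > 0"
    "\<And>j. j \<in> {1..d} \<Longrightarrow> (\<lambda>k. of_nat (q j) powr (- s k)) \<longlonglongrightarrow> z j"
    by (rule torus_point_is_limit[OF assms(1,2) z(1)]) blast+
  have lim: "(\<lambda>k. Re (\<phi> (s k))) \<longlonglongrightarrow> m"
    unfolding \<phi> m_def Re_sum by (intro tendsto_sum tendsto_Re tendsto_poly s(2))
  have ge: "m \<le> Re (\<phi> w)" if "Re w > 0" for w
    unfolding \<phi> m_def Re_sum using that
    by (intro sum_mono poly_Re_ge_on_disc[OF z(2)] norm_nat_powr_le_1) simp_all
  have q: "q j > 0" if "j \<in> {1..d}" for j
    using assms(2) that by (force simp: rat_independent_integers_def)
  show "m \<ge> 1/2"
    by (rule tendsto_lowerbound[OF lim])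
       (use polynomial_symbol_range[OF \<phi> assms(4) q s(1)] in \<open>auto intro!: always_eventually less_imp_le\<close>)
  show "(INF s\<in>right_halfplane 0. Re (\<phi> s)) = m"
  proof (rule antisym)
    have "bdd_below ((\<lambda>s. Re (\<phi> s)) ` right_halfplane 0)"
      using ge by (intro bdd_belowI2[of _ m]) (auto simp: right_halfplane_def)
    then have "(INF s\<in>right_halfplane 0. Re (\<phi> s)) \<le> Re (\<phi> (s k))" for k
      using s(1) by (intro cINF_lower) (auto simp: right_halfplane_def)
    then show "(INF s\<in>right_halfplane 0. Re (\<phi> s)) \<le> m"
      by (intro tendsto_lowerbound[OF lim] always_eventually) auto
    show "m \<le> (INF s\<in>right_halfplane 0. Re (\<phi> s))"
      using ge s(1)[of 0] by (intro cINF_greatest) (auto simp: right_halfplane_def)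
  qed
qed

section \<open>Uniqueness of Dirichlet coefficients\<close>

text \<open>Once all smaller coefficients vanish, the n-th term is minus the tail. At
  \<open>x = \<sigma> + k\<close>, multiplication by \<open>n powr x\<close> bounds
  \<open>b n\<close> by a constant times the k-th power of n / (n + 1).\<close>

lemma dirichlet_series_unique:
  fixes b :: "nat \<Rightarrow> complex"
  assumes sm: "summable (\<lambda>n. norm (b n * of_nat n powr (- of_real \<sigma>)))"
    and zero: "\<And>x. x \<ge> \<sigma> \<Longrightarrow> (\<Sum>n. b n * of_nat n powr (- of_real x)) = 0"
    and "n > 0"
  shows "b n = 0"
  using \<open>n > 0\<close>
proof (induction n rule: less_induct)
  case (less n)
  define g where "g l = norm (b l * of_nat l powr (- of_real \<sigma>))" for l
  define A where "A = (\<Sum>l. g l) * real n powr \<sigma>"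
  have sg: "summable g" using sm unfolding g_def[abs_def] .
  have bound: "norm (b n) \<le> (real n / real (Suc n)) powr (real k) * A" for k :: nat
  proof -
    define x where "x = \<sigma> + real k"
    define f where "f l = b l * of_nat l powr (- of_real x)" for l
    have term_le: "norm (f l) \<le> g l * real (Suc n) powr (- real k)" if "l \<ge> Suc n" for l
    proof -
      have "norm (f l) = g l * real l powr (- real k)"
        using that by (simp add: f_def g_def norm_mult norm_of_nat_powr x_def powr_add[symmetric])
      also have "\<dots> \<le> g l * real (Suc n) powr (- real k)"
        using that by (intro mult_left_mono powr_mono2') (auto simp: g_def)
      finally show ?thesis .
    qed
    have sf: "summable (\<lambda>l. norm (f l))"
      by (rule summable_comparison_test'[where N = "Suc n" and g = "\<lambda>l. g l * real (Suc n) powr (- real k)"])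
         (use term_le in \<open>auto intro!: summable_mult2 sg\<close>)
    have "0 = (\<Sum>l. f l)" using zero[of x] by (simp add: x_def f_def)
    also have "\<dots> = (\<Sum>l. f (l + Suc n)) + (\<Sum>l<Suc n. f l)"
      by (rule suminf_split_initial_segment[OF summable_norm_cancel[OF sf]])
    also have "(\<Sum>l<Suc n. f l) = f n"
    proof -
      have "f l = 0" if "l < n" for l
        using less.IH[of l] that by (cases "l = 0") (auto simp: f_def)
      then show ?thesis by simp
    qed
    finally have "norm (f n) = norm (\<Sum>l. f (l + Suc n))"
      by (metis add_eq_0_iff norm_minus_cancel)
    also have "\<dots> \<le> (\<Sum>l. norm (f (l + Suc n)))"
      using sf by (intro summable_norm) (subst summable_iff_shift)
    also have "\<dots> \<le> (\<Sum>l. g (l + Suc n) * real (Suc n) powr (- real k))"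
      using sf sg term_le by (intro suminf_le summable_mult2) (auto simp: summable_iff_shift[where f = "\<lambda>l. norm (f l)"] summable_iff_shift[where f = g] simp del: add_Suc_right)
    also have "\<dots> = (\<Sum>l. g (l + Suc n)) * real (Suc n) powr (- real k)"
      using sg by (intro suminf_mult2[symmetric]) (subst summable_iff_shift)
    also have "\<dots> \<le> (\<Sum>l. g l) * real (Suc n) powr (- real k)"
    proof -
      have "(\<Sum>l. g l) = (\<Sum>l. g (l + Suc n)) + (\<Sum>l<Suc n. g l)"
        by (rule suminf_split_initial_segment[OF sg])
      moreover have "(\<Sum>l<Suc n. g l) \<ge> 0" by (intro sum_nonneg) (auto simp: g_def)
      ultimately show ?thesis by (intro mult_right_mono) auto
    qed
    finally have "norm (f n) * real n powr x \<le> (\<Sum>l. g l) * real (Suc n) powr (- real k) * real n powr x"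
      by (intro mult_right_mono) auto
    moreover have "norm (f n) * real n powr x = norm (b n)"
      using less.prems by (simp add: f_def norm_mult norm_inverse norm_of_nat_powr powr_minus)
    moreover have "(\<Sum>l. g l) * real (Suc n) powr (- real k) * real n powr x = (real n / real (Suc n)) powr (real k) * A"
      by (simp add: A_def x_def powr_add powr_divide powr_minus divide_simps)
    ultimately show ?thesis by simp
  qed
  have "(\<lambda>k. (real n / real (Suc n)) ^ k) \<longlonglongrightarrow> 0"
    by (rule LIMSEQ_realpow_zero) auto
  moreover have "(real n / real (Suc n)) powr (real k) = (real n / real (Suc n)) ^ k" for k
    using less.prems by (intro powr_realpow) auto
  ultimately have "(\<lambda>k. (real n / real (Suc n)) powr (real k) * A) \<longlonglongrightarrow> 0"
    by (simp add: tendsto_mult_left_zero)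
  then have "norm (b n) \<le> 0"
    using bound by (intro tendsto_lowerbound[where F = sequentially]) auto
  then show "b n = 0" by simp
qed

lemma h2_eval_eq_0_imp:
  assumes "\<And>s. Re s > 1/2 \<Longrightarrow> h2_eval f s = 0"
  shows "f = 0"
proof -
  have "h2_coeff f n = 0" if "n > 0" for n
  proof (rule dirichlet_series_unique[OF _ _ that])
    show "summable (\<lambda>n. norm (h2_coeff f n * of_nat n powr (- of_real 1)))"
      using h2_eval_summable[of 1 f] by simp
    show "(\<Sum>n. h2_coeff f n * of_nat n powr (- of_real x)) = 0" if "x \<ge> 1" for x
      using assms[of "of_real x"] that by (simp add: h2_eval_def dirichlet_series_def)
  qed
  then have "h2_coeff f n = 0" for n by (cases "n = 0") auto
  then show ?thesis by (simp add: h2_coeff_inject[symmetric] fun_eq_iff zero_dirichlet_h2.rep_eq)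
qed

text \<open>An operator is specified only through values on \<open>Re s > 1/2\<close>. Uniqueness of
  coefficients recovers from them the Taylor coefficients of F, placed at the powers of q.\<close>

lemma h2_coeff_power:
  assumes q: "q \<ge> 2" and F: "F holomorphic_on UNIV"
    and eq: "\<And>s. Re s > 1/2 \<Longrightarrow> h2_eval g s = F (of_nat q powr (- s))"
  shows "h2_coeff g (q ^ k) = taylor_coeff F k"
proof -
  define h where "h k = q ^ k" for k
  have inj: "inj h" using q by (auto simp: h_def inj_def)
  define \<beta> where "\<beta> l = (if l \<in> range h then taylor_coeff F (inv h l) else 0)" for l
  have \<beta>: "\<beta> (h k) = taylor_coeff F k" for k by (simp add: \<beta>_def inj)
  have hs: "((\<lambda>l. \<beta> l * of_nat l powr (- s)) has_sum F (of_nat q powr (- s))) UNIV" if "Re s > 0" for s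
  proof -
    have "summable (\<lambda>k. norm (taylor_coeff F k * (of_nat q powr (- s)) ^ k))"
      using that norm_nat_powr_le_1[of s q]
      by (intro summable_comparison_test'[OF summable_norm_taylor_coeff[OF F]])
         (auto simp: norm_mult norm_power intro!: mult_left_le power_le_one)
    then have "((\<lambda>k. taylor_coeff F k * (of_nat q powr (- s)) ^ k) has_sum F (of_nat q powr (- s))) UNIV"
      by (rule norm_summable_imp_has_sum) (rule taylor_coeff_sums[OF F])
    moreover have "of_nat (h k) powr (- s) = (of_nat q powr (- s)) ^ k" for k
      using q unfolding h_def by (intro of_nat_power_powr) auto
    ultimately have "((\<lambda>l. \<beta> l * of_nat l powr (- s)) has_sum F (of_nat q powr (- s))) (range h)"
      by (subst has_sum_reindex[OF inj]) (simp add: o_def \<beta>)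
    then show ?thesis
      by (rule has_sum_cong_neutral[THEN iffD1, rotated -1]) (auto simp: \<beta>_def)
  qed
  have \<beta>sum: "summable (\<lambda>l. norm (\<beta> l * of_nat l powr (- s)))" if "Re s > 0" for s
    using has_sum_imp_summable[OF hs[OF that]]
    unfolding summable_on_iff_abs_summable_on_complex by (rule summable_on_imp_summable)
  have "h2_coeff g l - \<beta> l = 0" if "l > 0" for l
  proof (rule dirichlet_series_unique[where b = "\<lambda>l. h2_coeff g l - \<beta> l" and \<sigma> = 1, OF _ _ that])
    show "summable (\<lambda>n. norm ((h2_coeff g n - \<beta> n) * of_nat n powr (- of_real 1)))"
      by (rule summable_comparison_test'[OF summable_add[OF h2_eval_summable[of 1 g] \<beta>sum[of 1]]])
         (auto simp: left_diff_distrib norm_triangle_ineq4)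
    fix x :: real assume x: "x \<ge> 1"
    have "(\<lambda>l. h2_coeff g l * of_nat l powr (- of_real x) - \<beta> l * of_nat l powr (- of_real x)) sums
        (h2_eval g (of_real x) - F (of_nat q powr (- of_real x)))"
      using x by (intro sums_diff h2_eval_sums has_sum_imp_sums[OF hs]) auto
    then show "(\<Sum>n. (h2_coeff g n - \<beta> n) * of_nat n powr (- of_real x)) = 0"
      using eq[of "of_real x"] x by (simp add: sums_iff left_diff_distrib)
  qed
  from this[of "h k"] show ?thesis using q \<beta>[of k] by (simp add: h_def)
qed

text \<open>The reproducing kernel estimate of the Hardy space of the disc, whose squared norm here
  is part of that of g. It reaches every z in the disc, whereas the hypothesis on g concerns only
  \<open>Re s > 1/2\<close>.\<close>

lemma norm_sq_ge_point_value:
  assumes q: "q \<ge> 2" and F: "F holomorphic_on UNIV"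
    and eq: "\<And>s. Re s > 1/2 \<Longrightarrow> h2_eval g s = F (of_nat q powr (- s))"
    and z: "norm z < 1"
  shows "(1 - (norm z)\<^sup>2) * (norm (F z))\<^sup>2 \<le> (norm g)\<^sup>2"
proof -
  define c where "c = taylor_coeff F"
  have coeff: "h2_coeff g (q ^ k) = c k" for k
    unfolding c_def by (rule h2_coeff_power[OF q F eq])
  have inj: "inj (\<lambda>k. q ^ k)" using q by (auto simp: inj_def)
  have c_le: "(\<Sum>k\<in>A. (norm (c k))\<^sup>2) \<le> (norm g)\<^sup>2" if "finite A" for A
  proof -
    have "(\<Sum>k\<in>A. (norm (c k))\<^sup>2) = (\<Sum>l\<in>(\<lambda>k. q ^ k) ` A. (norm (h2_coeff g l))\<^sup>2)"
      using inj by (subst sum.reindex) (auto simp: coeff intro: inj_on_subset)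
    also have "\<dots> \<le> (norm g)\<^sup>2"
      unfolding norm_dirichlet_h2_sq by (intro sum_le_suminf h2_summable) (use that in auto)
    finally show ?thesis .
  qed
  have c_sum: "summable (\<lambda>k. (norm (c k))\<^sup>2)"
    by (rule bounded_imp_summable[where B = "(norm g)\<^sup>2"]) (auto intro: c_le)
  have z2: "(norm z)\<^sup>2 < 1" using z by (simp add: power_less_one_iff abs_square_less_1)
  have geo: "(\<lambda>k. ((norm z) ^ k)\<^sup>2) sums (1 / (1 - (norm z)\<^sup>2))"
    using geometric_sums[of "(norm z)\<^sup>2"] z2 by (simp add: power_mult[symmetric] mult.commute)
  note CS = Cauchy_Schwarz_suminf[OF c_sum sums_summable[OF geo]]
  have "norm (F z) \<le> (\<Sum>k. norm (c k) * norm z ^ k)"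
  proof -
    have "F z = (\<Sum>k. c k * z ^ k)" using taylor_coeff_sums[OF F, of z] by (simp add: sums_iff c_def)
    then show ?thesis
      using summable_norm[of "\<lambda>k. c k * z ^ k"] CS(1) by (simp add: norm_mult norm_power)
  qed
  then have "(norm (F z))\<^sup>2 \<le> (\<Sum>k. norm (c k) * norm z ^ k)\<^sup>2" by (intro power_mono) auto
  also have "\<dots> \<le> (\<Sum>k. (norm (c k))\<^sup>2) * (\<Sum>k. ((norm z) ^ k)\<^sup>2)" by (rule CS(2)) auto
  also have "\<dots> \<le> (norm g)\<^sup>2 * (1 / (1 - (norm z)\<^sup>2))"
    unfolding sums_unique[OF geo, symmetric] using z2
    by (intro mult_right_mono suminf_le_const c_sum c_le) auto
  finally show ?thesis using z2 by (simp add: pos_le_divide_eq mult.commute)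
qed

lemma powr_minus_diff_le:
  fixes a b p :: real
  assumes "0 < a" "a \<le> b" "0 \<le> p"
  shows "a powr (- p) - b powr (- p) \<le> p * a powr (- p - 1) * (b - a)"
proof (cases "a = b")
  case False
  then have "\<exists>z>a. z < b \<and> b powr (-p) - a powr (-p) = (b - a) * (- p * z powr (- p - 1))"
    using assms by (intro MVT2) (auto intro!: derivative_eq_intros)
  then obtain z where z: "a < z" "z < b" "b powr (-p) - a powr (-p) = (b - a) * (- p * z powr (- p - 1))"
    by blast
  have "z powr (- p - 1) \<le> a powr (- p - 1)"
    using z assms by (intro powr_mono2') auto
  then have "(b - a) * (p * z powr (- p - 1)) \<le> (b - a) * (p * a powr (- p - 1))"
    using assms by (intro mult_left_mono) auto
  then show ?thesis using z by (simp add: mult_ac)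
qed simp

text \<open>Telescoping against \<open>n powr (- \<eta>)\<close> gives \<open>\<eta>\<close> times
  the sum at least \<open>1 - (M + 1) powr (- \<eta>)\<close>, which exceeds 1/2 for large
  M.\<close>

lemma sum_powr_ge:
  assumes "\<eta> > 0"
  obtains M where "M > 0" "1 / (2 * \<eta>) \<le> (\<Sum>n=1..M. real n powr (- 1 - \<eta>))"
proof -
  have tel: "1 - real (Suc M) powr (- \<eta>) \<le> \<eta> * (\<Sum>n=1..M. real n powr (- 1 - \<eta>))" for M
  proof (induction M)
    case (Suc M)
    have "real (Suc M) powr (- \<eta>) - real (Suc (Suc M)) powr (- \<eta>) \<le> \<eta> * real (Suc M) powr (- 1 - \<eta>)"
      using powr_minus_diff_le[of "real (Suc M)" "real (Suc (Suc M))" \<eta>] assms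
      by (simp add: minus_diff_commute[of \<eta> 1])
    then show ?case using Suc by (simp add: distrib_left)
  qed simp
  have "(\<lambda>M. real (Suc M) powr (- \<eta>)) \<longlonglongrightarrow> 0"
    using assms by (intro LIMSEQ_Suc[of "\<lambda>M. real M powr (- \<eta>)"] tendsto_neg_powr filterlim_real_sequentially) auto
  then have "\<forall>\<^sub>F M in sequentially. real (Suc M) powr (- \<eta>) < 1 / 2"
    by (rule order_tendstoD) simp
  then obtain M where M: "\<And>m. m \<ge> M \<Longrightarrow> real (Suc m) powr (- \<eta>) < 1 / 2"
    by (auto simp: eventually_sequentially)
  have "1 / 2 \<le> \<eta> * (\<Sum>n=1..Suc M. real n powr (- 1 - \<eta>))"
    using tel[of "Suc M"] M[of "Suc M"] by simp
  with assms show thesis by (intro that[of "Suc M"]) (auto simp: divide_simps mult_ac)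
qed

section \<open>Failure of compactness\<close>

lemma poly_lipschitz_at:
  fixes P :: "complex poly"
  obtains K where "K > 0" "\<And>z. norm z \<le> 1 \<Longrightarrow> norm (poly P z - poly P z0) \<le> K * norm (z - z0)"
proof -
  have "poly (P - [:poly P z0:]) z0 = 0" by simp
  then obtain Q where Q: "P - [:poly P z0:] = [:- z0, 1:] * Q"
    unfolding poly_eq_0_iff_dvd by (auto elim: dvdE)
  have PQ: "poly P z - poly P z0 = (z - z0) * poly Q z" for z
    using arg_cong[OF Q, of "\<lambda>p. poly p z"] by (simp add: algebra_simps)
  have "bounded (poly Q ` cball 0 1)"
    by (intro compact_imp_bounded compact_continuous_image continuous_intros) auto
  then obtain K where K: "\<forall>x\<in>poly Q ` cball 0 1. norm x \<le> K" unfolding bounded_iff by blast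
  show thesis
  proof (rule that[of "\<bar>K\<bar> + 1"])
    fix z :: complex assume "norm z \<le> 1"
    then have "norm (poly Q z) \<le> \<bar>K\<bar> + 1" using K by force
    then show "norm (poly P z - poly P z0) \<le> (\<bar>K\<bar> + 1) * norm (z - z0)"
      by (simp add: PQ norm_mult mult.commute[of "norm (z - z0)"] mult_right_mono)
  qed simp
qed

lemma h2_finite_support:
  obtains f where "\<And>n. h2_coeff f n = (if n \<in> {1..M} then a n else 0)"
    "\<And>s. h2_eval f s = (\<Sum>n=1..M. a n * of_nat n powr (- s))"
    "(norm f)\<^sup>2 = (\<Sum>n=1..M. (norm (a n))\<^sup>2)"
proof -
  define c where "c n = (if n \<in> {1..M} then a n else 0)" for n :: nat
  have "summable (\<lambda>n. (norm (c n))\<^sup>2)"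
    by (rule summable_finite[of "{1..M}"]) (auto simp: c_def)
  then have c: "h2_coeff (Abs_dirichlet_h2 c) = c"
    by (intro Abs_dirichlet_h2_inverse) (auto simp: c_def)
  have "h2_eval (Abs_dirichlet_h2 c) s = (\<Sum>n=1..M. c n * of_nat n powr (- s))" for s
    unfolding h2_eval_def dirichlet_series_def c by (rule suminf_finite) (auto simp: c_def)
  moreover have "(norm (Abs_dirichlet_h2 c))\<^sup>2 = (\<Sum>n=1..M. (norm (c n))\<^sup>2)"
    unfolding norm_dirichlet_h2_sq c by (rule suminf_finite) (auto simp: c_def)
  ultimately show thesis
    by (intro that[of "Abs_dirichlet_h2 c"]) (auto simp: c c_def)
qed

text \<open>
  The test functions are truncated, normalised reproducing kernels at the points
  \<open>poly P ((1 - \<epsilon>) z\<^sub>0)\<close>: they tend to zero pointwise, but their images under the composition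
  operator, evaluated at \<open>(1 - \<epsilon>) z\<^sub>0\<close> in the disc, stay bounded below.
\<close>
lemma not_compact_composition_operator:
  assumes q: "q \<ge> 2" and "degree P > 0" and z0: "norm z0 = 1" "Re (poly P z0) = 1/2"
    and ge: "\<And>w. norm w = 1 \<Longrightarrow> 1/2 \<le> Re (poly P w)"
    and \<phi>: "\<And>s. \<phi> s = poly P (of_nat q powr (- s))"
    and \<phi>_range: "\<And>s. Re s > 1/2 \<Longrightarrow> Re (\<phi> s) > 1/2"
  shows "\<not> compact_composition_operator \<phi>"
proof
  assume "compact_composition_operator \<phi>"
  then obtain T where T: "is_composition_operator \<phi> T" and cT: "compact (closure (T ` cball 0 1))"
    by (auto simp: compact_composition_operator_def compact_operator_def)
  have evT: "h2_eval (T f) s = h2_eval f (\<phi> s)" if "Re s > 1/2" for f s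
    using T that by (auto simp: is_composition_operator_def right_halfplane_def)
  obtain K where K: "K > 0" "\<And>z. norm z \<le> 1 \<Longrightarrow> norm (poly P z - poly P z0) \<le> K * norm (z - z0)"
    using poly_lipschitz_at[of P z0] by blast
  define S where "S w = (\<Sum>n. real n powr (- 1/2 - Re w))" for w
  have S: "(\<Sum>n=1..M. real n powr (- 1/2 - Re w)) \<le> S w" if "Re w > 1/2" for w and M :: nat
    unfolding S_def by (rule sum_le_suminf) (use that in \<open>auto simp: summable_real_powr_iff\<close>)
  have test: "\<exists>g. norm g \<le> 1 \<and> 1 / (4 * K) \<le> (norm (T g))\<^sup>2 \<and>
      (\<forall>w. Re w > 1/2 \<longrightarrow> norm (h2_eval g w) \<le> S w * sqrt (4 * K * \<epsilon>))" if \<epsilon>: "0 < \<epsilon>" "\<epsilon> < 1" for \<epsilon>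
  proof -
    define z where "z = of_real (1 - \<epsilon>) * z0"
    have nz: "norm z = 1 - \<epsilon>" using \<epsilon> z0 by (simp add: z_def norm_mult del: of_real_diff)
    define u where "u = poly P z"
    define \<delta> where "\<delta> = Re u - 1/2"
    have "\<delta> > 0"
      unfolding \<delta>_def u_def using poly_Re_gt_in_disc[of "1/2" P z] poly_Re_ge_on_disc[OF ge] nz \<epsilon> assms(2) by force
    have "\<delta> \<le> K * \<epsilon>"
    proof -
      have "\<delta> \<le> norm (u - poly P z0)"
        using complex_Re_le_cmod[of "u - poly P z0"] z0 by (simp add: \<delta>_def)
      also have "\<dots> \<le> K * norm (z - z0)" unfolding u_def using nz \<epsilon> by (intro K) auto
      also have "z - z0 = of_real (- \<epsilon>) * z0" by (simp add: z_def algebra_simps)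
      also have "norm \<dots> = \<epsilon>" using z0 \<epsilon> by (simp add: norm_mult)
      finally show ?thesis .
    qed
    \<comment> \<open>Truncating the kernel keeps F a finite sum of entire functions; M is large
      enough for the squared norm N to keep the order \<open>1 / \<delta>\<close> of the full
      kernel.\<close>
    obtain M where M: "M > 0" "1 / (2 * (2 * \<delta>)) \<le> (\<Sum>n=1..M. real n powr (- 1 - 2 * \<delta>))"
      using sum_powr_ge[of "2 * \<delta>"] \<open>\<delta> > 0\<close> by auto
    define N where "N = (\<Sum>n=1..M. real n powr (- 1 - 2 * \<delta>))"
    have N: "1 / (4 * \<delta>) \<le> N" using M by (simp add: N_def)
    have "N > 0" using N \<open>\<delta> > 0\<close> by (smt (verit) divide_pos_pos)
    \<comment> \<open>The conjugate makes every term of F at z a positive real, so F there equals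
      \<open>N / sqrt N\<close>, while the division by \<open>sqrt N\<close> gives g norm 1.\<close>
    define a where "a n = of_nat n powr (- cnj u) / of_real (sqrt N)" for n
    have na: "norm (a n) = real n powr (- 1/2 - \<delta>) / sqrt N" for n
      using \<open>N > 0\<close> by (simp add: a_def norm_divide norm_of_nat_powr \<delta>_def)
    obtain g where g: "\<And>s. h2_eval g s = (\<Sum>n=1..M. a n * of_nat n powr (- s))"
      "(norm g)\<^sup>2 = (\<Sum>n=1..M. (norm (a n))\<^sup>2)"
      by (rule h2_finite_support[of M a]) blast
    have "(norm g)\<^sup>2 = 1"
    proof -
      have "(norm (a n))\<^sup>2 = real n powr (- 1 - 2 * \<delta>) / N" if "n \<in> {1..M}" for n
        using that \<open>N > 0\<close> by (simp add: na power_divide powr_power algebra_simps)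
      then have "(norm g)\<^sup>2 = N / N" unfolding g(2) N_def by (simp flip: sum_divide_distrib)
      then show ?thesis using \<open>N > 0\<close> by simp
    qed
    then have "norm g = 1" using norm_ge_zero[of g] unfolding power2_eq_1_iff by linarith
    define F where "F z = (\<Sum>n=1..M. a n * base_power n P z)" for z
    have "(1 - (norm z)\<^sup>2) * (norm (F z))\<^sup>2 \<le> (norm (T g))\<^sup>2"
    proof (rule norm_sq_ge_point_value[OF q])
      show "F holomorphic_on UNIV" unfolding F_def by (intro holomorphic_intros holomorphic_base_power)
      show "h2_eval (T g) s = F (of_nat q powr (- s))" if "Re s > 1/2" for s
        using evT[OF that, of g] by (simp add: g F_def \<phi>)
    qed (use nz \<epsilon> in simp)
    moreover have "F z = of_real (sqrt N)"
    proof -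
      have "a n * base_power n P z = of_real (real n powr (- 1 - 2 * \<delta>) / sqrt N)" if "n \<in> {1..M}" for n
      proof -
        have "- cnj u + - u = of_real (- 1 - 2 * \<delta>)" by (simp add: \<delta>_def complex_eq_iff)
        then have "of_nat n powr (- cnj u) * of_nat n powr (- u) = (of_nat n :: complex) powr of_real (- 1 - 2 * \<delta>)"
          by (metis powr_add)
        also have "\<dots> = of_real (real n powr (- 1 - 2 * \<delta>))"
          using powr_of_real[of "real n" "- 1 - 2 * \<delta>"] by simp
        finally show ?thesis by (simp add: a_def u_def)
      qed
      then have "F z = of_real (N / sqrt N)"
        by (simp add: F_def N_def flip: sum_divide_distrib of_real_sum of_real_divide)
      then show ?thesis using \<open>N > 0\<close> by (simp add: real_div_sqrt)
    qed
    \<comment> \<open>Here \<open>1 - (1 - \<epsilon>)\<^sup>2\<close> is at least \<epsilon> and N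
      is at least \<open>1 / (4 * \<delta>)\<close>. The contact of Re P with 1/2 at
      \<open>z0\<close> makes \<delta> at most \<open>K * \<epsilon>\<close>, so \<epsilon>
      cancels.\<close>
    moreover have "1 / (4 * K) \<le> (1 - (norm z)\<^sup>2) * N"
    proof -
      have "1 / (4 * K) \<le> \<epsilon> * (1 / (4 * \<delta>))"
        using \<open>\<delta> > 0\<close> \<open>\<delta> \<le> K * \<epsilon>\<close> K \<epsilon> by (simp add: field_simps)
      also have "\<dots> \<le> \<epsilon> * N" using N \<epsilon> by (intro mult_left_mono) auto
      also have "\<epsilon> * N \<le> (1 - (norm z)\<^sup>2) * N"
        using \<epsilon> \<open>N > 0\<close> mult_left_mono[of \<epsilon> 1 \<epsilon>] unfolding nz
        by (intro mult_right_mono) (auto simp: power2_eq_square algebra_simps)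
      finally show ?thesis .
    qed
    ultimately have "1 / (4 * K) \<le> (norm (T g))\<^sup>2" using \<open>N > 0\<close> by simp
    \<comment> \<open>Only the normalisation is small: \<open>1 / sqrt N\<close> is at most
      \<open>sqrt (4 * \<delta>)\<close>. The remaining sum is dominated by a convergent series,
      since \<open>1/2 + Re w > 1\<close>.\<close>
    moreover have "norm (h2_eval g w) \<le> S w * sqrt (4 * K * \<epsilon>)" if w: "Re w > 1/2" for w
    proof -
      have "norm (h2_eval g w) \<le> (\<Sum>n=1..M. real n powr (- 1/2 - Re w) * sqrt (4 * K * \<epsilon>))"
        unfolding g
      proof (intro order_trans[OF norm_sum] sum_mono)
        fix n assume n: "n \<in> {1..M}"
        have "1 / N \<le> 4 * \<delta>" using N \<open>\<delta> > 0\<close> \<open>N > 0\<close> by (simp add: field_simps)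
        then have "sqrt (1 / N) \<le> sqrt (4 * K * \<epsilon>)"
          using \<open>\<delta> \<le> K * \<epsilon>\<close> by (intro real_sqrt_le_mono) linarith
        then have "1 / sqrt N \<le> sqrt (4 * K * \<epsilon>)"
          by (simp only: real_sqrt_divide real_sqrt_one)
        moreover have "norm (a n * of_nat n powr (- w)) = real n powr (- 1/2 - \<delta> - Re w) * (1 / sqrt N)"
          using n by (simp add: norm_mult na norm_of_nat_powr powr_add[symmetric])
        moreover have "real n powr (- 1/2 - \<delta> - Re w) \<le> real n powr (- 1/2 - Re w)"
          using n \<open>\<delta> > 0\<close> by (intro powr_mono) auto
        ultimately show "norm (a n * of_nat n powr (- w)) \<le> real n powr (- 1/2 - Re w) * sqrt (4 * K * \<epsilon>)"
          using \<open>N > 0\<close> by (metis mult_mono powr_ge_zero divide_nonneg_pos zero_le_one real_sqrt_gt_zero)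
      qed
      also have "\<dots> \<le> S w * sqrt (4 * K * \<epsilon>)"
        unfolding sum_distrib_right[symmetric] using K \<epsilon> by (intro mult_right_mono S w) auto
      finally show ?thesis .
    qed
    ultimately show ?thesis using \<open>norm g = 1\<close> by (intro exI[of _ g]) auto
  qed
  \<comment> \<open>The choice \<epsilon> = 1 / (i + 2) stays below 1 also for
    \<open>i = 0\<close>.\<close>
  have "\<exists>g. norm g \<le> 1 \<and> 1 / (4 * K) \<le> (norm (T g))\<^sup>2 \<and>
      (\<forall>w. Re w > 1/2 \<longrightarrow> norm (h2_eval g w) \<le> S w * sqrt (4 * K * inverse (real (Suc (Suc i)))))" for i
    by (rule test) (auto simp: field_simps)
  then obtain g where g: "\<And>i. norm (g i) \<le> 1" "\<And>i. 1 / (4 * K) \<le> (norm (T (g i)))\<^sup>2"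
      "\<And>i w. Re w > 1/2 \<Longrightarrow> norm (h2_eval (g i) w) \<le> S w * sqrt (4 * K * inverse (real (Suc (Suc i))))"
    by metis
  have "T (g i) \<in> closure (T ` cball 0 1)" for i
    using g(1)[of i] closure_subset by fastforce
  then obtain l r where r: "strict_mono r" "((\<lambda>i. T (g i)) \<circ> r) \<longlonglongrightarrow> l"
    using cT[unfolded compact_def, rule_format, of "\<lambda>i. T (g i)"] by blast
  have lim0: "(\<lambda>i. h2_eval (g i) w) \<longlonglongrightarrow> 0" if w: "Re w > 1/2" for w
  proof (rule Lim_null_comparison)
    have "(\<lambda>i. S w * sqrt (4 * K * inverse (real (Suc (Suc i))))) \<longlonglongrightarrow> S w * sqrt (4 * K * 0)"
      by (intro tendsto_intros LIMSEQ_Suc[OF LIMSEQ_inverse_real_of_nat])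
    then show "(\<lambda>i. S w * sqrt (4 * K * inverse (real (Suc (Suc i))))) \<longlonglongrightarrow> 0" by simp
  qed (use g(3)[OF w] in auto)
  \<comment> \<open>Evaluating an image at s means evaluating the test function at
    \<open>\<phi> s\<close>, and those values tend to 0; the lower bound on the norms then
    contradicts \<open>l = 0\<close>.\<close>
  have "l = 0"
  proof (rule h2_eval_eq_0_imp)
    fix s :: complex assume s: "Re s > 1/2"
    have "(\<lambda>i. h2_eval (((\<lambda>i. T (g i)) \<circ> r) i) s) \<longlonglongrightarrow> h2_eval l s"
      by (rule h2_eval_tendsto[OF s r(2)])
    moreover have "(\<lambda>i. h2_eval (((\<lambda>i. T (g i)) \<circ> r) i) s) \<longlonglongrightarrow> 0"
      using LIMSEQ_subseq_LIMSEQ[OF lim0[OF \<phi>_range[OF s]] r(1)] by (simp add: o_def evT[OF s])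
    ultimately show "h2_eval l s = 0" by (rule LIMSEQ_unique)
  qed
  have "(\<lambda>i. (norm (((\<lambda>i. T (g i)) \<circ> r) i))\<^sup>2) \<longlonglongrightarrow> (norm l)\<^sup>2"
    by (intro tendsto_intros r(2))
  then have "1 / (4 * K) \<le> (norm l)\<^sup>2"
    by (rule tendsto_lowerbound) (auto simp: g(2))
  with \<open>l = 0\<close> K(1) show False by simp
qed

text \<open>With each circle mean normalised to \<open>e j n\<close> in [0, 1], the weight is
  \<open>n powr (1 - 2 * m)\<close> times the product of the \<open>e j n\<close> from 2 on, where m
  is the sum of the \<mu> j. If \<open>m > 1/2\<close>, the power tends to 0; if
  \<open>m = 1/2\<close>, the factor \<open>e 2 n\<close> does.\<close>

lemma expansion_weight_tendsto:
  fixes d :: nat and P :: "nat \<Rightarrow> complex poly"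
  assumes "d \<ge> 1" and deg: "\<And>j. j \<in> {1..d} \<Longrightarrow> degree (P j) > 0"
    and \<mu>: "\<And>j w. j \<in> {1..d} \<Longrightarrow> norm w = 1 \<Longrightarrow> \<mu> j \<le> Re (poly (P j) w)"
    and "(\<Sum>j=1..d. \<mu> j) \<ge> 1/2" and *: "(\<Sum>j=1..d. \<mu> j) \<noteq> 1/2 \<or> d \<ge> 2"
  shows "(\<lambda>n. real n powr (1 - 2 * \<mu> 1) * (\<Prod>j=2..d. circle_mean_sq n (P j))) \<longlonglongrightarrow> 0"
proof -
  define m where "m = (\<Sum>j=1..d. \<mu> j)"
  define e where "e j n = real n powr (2 * \<mu> j) * circle_mean_sq n (P j)" for j n
  have e: "0 \<le> e j n" "e j n \<le> 1" if "j \<in> {1..d}" for j n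
  proof -
    show "0 \<le> e j n" by (simp add: e_def circle_mean_sq_nonneg)
    have "e j n \<le> real n powr (2 * \<mu> j) * real n powr (- 2 * \<mu> j)"
      unfolding e_def using \<mu>[OF that] by (intro mult_left_mono circle_mean_sq_le) auto
    also have "\<dots> \<le> 1" by (cases "n = 0") (auto simp flip: powr_add)
    finally show "e j n \<le> 1" .
  qed
  have split: "{1..d} = insert 1 {2..d}" using assms(1) by auto
  have eq: "real n powr (1 - 2 * \<mu> 1) * (\<Prod>j=2..d. circle_mean_sq n (P j)) =
      real n powr (1 - 2 * m) * (\<Prod>j=2..d. e j n)" for n
  proof (cases "n = 0")
    case False
    have "(\<Prod>j=2..d. e j n) = real n powr (\<Sum>j=2..d. 2 * \<mu> j) * (\<Prod>j=2..d. circle_mean_sq n (P j))"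
      unfolding e_def prod.distrib using False by (subst powr_sum) auto
    moreover have "1 - 2 * \<mu> 1 = (1 - 2 * m) + (\<Sum>j=2..d. 2 * \<mu> j)"
      unfolding m_def split by (simp add: sum_distrib_left)
    ultimately show ?thesis by (simp only: powr_add mult.assoc)
  qed auto
  have prod_le: "(\<Prod>j\<in>J. e j n) \<le> 1" "0 \<le> (\<Prod>j\<in>J. e j n)" if "J \<subseteq> {1..d}" for J n
    using e that by (auto intro!: prod_le_1 prod_nonneg)
  have "(\<lambda>n. real n powr (1 - 2 * m) * (\<Prod>j=2..d. e j n)) \<longlonglongrightarrow> 0"
  proof (cases "m = 1/2")
    case False
    then have "m > 1/2" using assms(4) by (simp add: m_def)
    then have "(\<lambda>n. real n powr (1 - 2 * m)) \<longlonglongrightarrow> 0"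
      by (intro tendsto_neg_powr filterlim_real_sequentially) auto
    then show ?thesis
      by (rule Lim_null_comparison[rotated])
         (use prod_le[of "{2..d}"] in \<open>auto simp: abs_mult intro!: mult_left_le always_eventually\<close>)
  next
    case True
    then have "d \<ge> 2" using * by (auto simp: m_def)
    then have split2: "{2..d} = insert 2 {3..d}" by auto
    have "(\<lambda>n. e 2 n) \<longlonglongrightarrow> 0"
      unfolding e_def using \<open>d \<ge> 2\<close> by (intro circle_mean_sq_tendsto deg \<mu>) auto
    moreover have "norm (real n powr (1 - 2 * m) * (\<Prod>j=2..d. e j n)) \<le> e 2 n" for n
    proof -
      have "norm (real n powr (1 - 2 * m) * (\<Prod>j=2..d. e j n)) \<le> (\<Prod>j=2..d. e j n)"
        unfolding True using prod_le[of "{2..d}" n] by (cases "n = 0") (auto simp: abs_mult)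
      also have "\<dots> = e 2 n * (\<Prod>j=3..d. e j n)" unfolding split2 by simp
      also have "\<dots> \<le> e 2 n" using prod_le[of "{3..d}" n] e[of 2 n] \<open>d \<ge> 2\<close> by (intro mult_left_le) auto
      finally show ?thesis .
    qed
    ultimately show ?thesis
      by (rule_tac Lim_null_comparison[where g = "e 2"]) (auto intro: always_eventually)
  qed
  then show ?thesis by (simp only: eq)
qed

theorem theorem2:
  fixes d :: nat
    and q :: "nat \<Rightarrow> nat"
    and P :: "nat \<Rightarrow> complex poly"
    and \<phi> :: "complex \<Rightarrow> complex"
  assumes "d \<ge> 1"
    and "inj_on q {1..d}"
    and "rat_independent_integers (q ` {1..d})"
    and "\<And>j. j \<in> {1..d} \<Longrightarrow> degree (P j) > 0"
    and "\<And>s. \<phi> s = (\<Sum>j=1..d. poly (P j) (of_nat (q j) powr (- s)))"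
    and "\<phi> \<in> gordon_hedenmalm"
  shows "compact_composition_operator \<phi> \<longleftrightarrow> restricted_range \<phi> \<or> d \<ge> 2"
proof -
  have q2: "q j \<ge> 2" if "j \<in> {1..d}" for j
    using assms(3) that by (force simp: rat_independent_integers_def)
  have "\<exists>z. norm z = 1 \<and> (\<forall>w. norm w = 1 \<longrightarrow> Re (poly (P j) z) \<le> Re (poly (P j) w))" for j
    using poly_Re_circle_min[of "P j"] by metis
  then obtain z where z: "\<And>j. norm (z j) = 1"
    "\<And>j w. norm w = 1 \<Longrightarrow> Re (poly (P j) (z j)) \<le> Re (poly (P j) w)" by metis
  define \<mu> where "\<mu> j = Re (poly (P j) (z j))" for j
  have inf: "(INF s\<in>right_halfplane 0. Re (\<phi> s)) = (\<Sum>j=1..d. \<mu> j)" and ge: "(\<Sum>j=1..d. \<mu> j) \<ge> 1/2"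
    using polynomial_symbol_infimum[where z = z, OF assms(2,3,5,6)] z by (auto simp: \<mu>_def)
  have unres: "unrestricted_range \<phi> \<longleftrightarrow> (\<Sum>j=1..d. \<mu> j) = 1/2"
    by (simp add: unrestricted_range_def inf)
  have range: "Re (\<phi> s) > 1/2" if "Re s > 1/2" for s
    by (rule polynomial_symbol_range[OF assms(5,6)]) (use q2 that in force)+
  show ?thesis
  proof
    assume *: "restricted_range \<phi> \<or> d \<ge> 2"
    obtain B C where "C > 0" and exp: "composition_expansion (generated_monoid q d) B
        (\<lambda>s. \<Sum>j=1..d. poly (P j) (of_nat (q j) powr (- s)))
        (\<lambda>n. C * real n powr (1 - 2 * \<mu> 1) * (\<Prod>j=2..d. circle_mean_sq n (P j)))"
      by (rule composition_expansion_exists[where P = P and \<mu> = "\<mu> 1", OF assms(1-3)])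
         (use assms(1,4) z(2) in \<open>auto simp: \<mu>_def\<close>)
    have "(\<lambda>n. real n powr (1 - 2 * \<mu> 1) * (\<Prod>j=2..d. circle_mean_sq n (P j))) \<longlonglongrightarrow> 0"
      using assms(1,4) z(2) ge * by (intro expansion_weight_tendsto) (auto simp: \<mu>_def unres)
    then have "(\<lambda>n. C * real n powr (1 - 2 * \<mu> 1) * (\<Prod>j=2..d. circle_mean_sq n (P j))) \<longlonglongrightarrow> 0"
      unfolding mult.assoc by (rule tendsto_mult_right_zero)
    \<comment> \<open>All the \<open>q j\<close> are at least 2, so no product of their powers
      vanishes.\<close>
    moreover have "0 \<notin> generated_monoid q d"
      using q2 by (force simp: generated_monoid_def)
    ultimately show "compact_composition_operator \<phi>"
      using exp \<open>C > 0\<close> range unfolding assms(5)[symmetric]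
      by (intro compact_composition_operator_if_expansion)
         (auto intro!: mult_nonneg_nonneg prod_nonneg circle_mean_sq_nonneg)
  next
    assume compact: "compact_composition_operator \<phi>"
    show "restricted_range \<phi> \<or> d \<ge> 2"
    proof (rule ccontr)
      assume "\<not> ?thesis"
      then have "d = 1" using assms(1) by simp
      with \<open>\<not> ?thesis\<close> have "\<mu> 1 = 1/2" using unres by simp
      have "\<not> compact_composition_operator \<phi>"
      proof (rule not_compact_composition_operator)
        show "q 1 \<ge> 2" "degree (P 1) > 0" using q2 assms(4) \<open>d = 1\<close> by simp_all
        show "Re (poly (P 1) (z 1)) = 1/2"
          using \<open>\<mu> 1 = 1/2\<close> by (simp only: \<mu>_def)
        then show "1/2 \<le> Re (poly (P 1) w)" if "norm w = 1" for w
          using z(2)[OF that, of 1] by linarith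
        show "\<phi> s = poly (P 1) (of_nat (q 1) powr (- s))" for s
          using assms(5)[of s] \<open>d = 1\<close> by simp
      qed (rule z(1) range, assumption?)+
      with compact show False by contradiction
    qed
  qed
qed

end
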